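(* Let $\widehat{\mathcal{A}}_\infty$ be a UHF algebra with canonical masa $\widehat{\mathcal{D}}_\infty$ and let $R(\widehat{\mathcal{A}}_\infty)$ be its associated topological equivalence relation. For an open, reflexive and symmetric subset $P\subseteq R(\widehat{\mathcal{A}}_\infty)$ let $\mathcal{S}_\infty(P)=\overline{\mathrm{span}}\{d\,e^k_{i,j}f:d,f\in\widehat{\mathcal{D}}_\infty,\ E^k_{i,j}\subseteq P\}$. Then the map $P\mapsto\mathcal{S}_\infty(P)$ is a bijective correspondence between the open subgraphs (i.e. open, reflexive, symmetric subsets) of $R(\widehat{\mathcal{A}}_\infty)$ and the concrete operator $\widehat{\mathcal{D}}_\infty$-systems in $\widehat{\mathcal{A}}_\infty$.
   Context: UHF setting: $(n_k)_{k\in\mathbb{N}}$ are positive integers with $n_k\mid n_{k+1}$, $l_k=n_{k+1}/n_k$, $e^k_{i,j}$ ($1\le i,j\le n_k$) are the canonical matrix units of $M_{n_k}(\mathbb{C})$, and $\pi_k:M_{n_k}\to M_{n_{k+1}}$ is the unital $*$-homomorphism with $\pi_k(e^k_{i,j})=\sum_{r=0}^{l_k-1}e^{k+1}_{rn_k+i,\,rn_k+j}$. $\widehat{\mathcal{A}}_\infty=\varinjlim_{\mathbf{C}^*}(M_{n_k},\pi_k)$; matrix units are identified with their images in $\widehat{\mathcal{A}}_\infty$; $\mathcal{D}_k$ is the algebra of diagonal matrices in (the image of) $M_{n_k}$ and $\widehat{\mathcal{D}}_\infty=\overline{\bigcup_k\mathcal{D}_k}$ is the canonical masa. A concrete operator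 $\widehat{\mathcal{D}}_\infty$-system is a norm-closed selfadjoint subspace $\mathcal{S}\subseteq\widehat{\mathcal{A}}_\infty$ with $\widehat{\mathcal{D}}_\infty\subseteq\mathcal{S}$ and $\widehat{\mathcal{D}}_\infty\mathcal{S}\widehat{\mathcal{D}}_\infty\subseteq\mathcal{S}$. $X_\infty$ is the Gelfand spectrum of $\widehat{\mathcal{D}}_\infty$, and $X_i^k=\{x\in X_\infty:x(e^k_{i,i})=1\}$. For $y\in X_j^k$, let $\alpha^k_{i,j}(y)\in X_i^k$ be the character $d\mapsto y(e^k_{j,i}\,d\,e^k_{i,j})$ of $\widehat{\mathcal{D}}_\infty$; $\alpha_{i,j}^k:X_j^k\to X_i^k$ is a homeomorphism, and $E^k_{i,j}=\{(\alpha^k_{i,j}(y),y):y\in X_j^k\}\subseteq X_\infty\times X_\infty$. Then $R(\widehat{\mathcal{A}}_\infty)=\bigcup\{E^k_{i,j}:k\in\mathbb{N},1\le i,j\le n_k\}$ is an equivalence relation on $X_\infty$, with the topology having the sets $E^k_{i,j}$ as a base of open sets. A subset is reflexive if it contains $\{(x,x):x\in X_\infty\}$. *)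

theory Defs
  imports "HOL-Analysis.Analysis" "Jordan_Normal_Form.Schur_Decomposition"
begin

text \<open>Unital complex C*-algebras with \<open>1 \<noteq> 0\<close>. The class \<^class>\<open>real_normed_algebra_1\<close> supplies the
  underlying real normed algebra, in particular submultiplicativity of the norm.\<close>

class cstar_algebra_1 = real_normed_algebra_1 + complete_space +
  fixes scaleC :: "complex \<Rightarrow> 'a \<Rightarrow> 'a" (infixr \<open>*\<^sub>C\<close> 75)
    and star :: "'a \<Rightarrow> 'a"
  assumes scaleC_add_right: "c *\<^sub>C (x + y) = c *\<^sub>C x + c *\<^sub>C y"
    and scaleC_add_left: "(c + d) *\<^sub>C x = c *\<^sub>C x + d *\<^sub>C x"
    and scaleC_scaleC: "c *\<^sub>C d *\<^sub>C x = (c * d) *\<^sub>C x"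
    and scaleC_of_real: "complex_of_real r *\<^sub>C x = r *\<^sub>R x"
    and mult_scaleC_left: "(c *\<^sub>C x) * y = c *\<^sub>C (x * y)"
    and mult_scaleC_right: "x * (c *\<^sub>C y) = c *\<^sub>C (x * y)"
    and norm_scaleC: "norm (c *\<^sub>C x) = cmod c * norm x"
    and star_star: "star (star x) = x"
    and star_add: "star (x + y) = star x + star y"
    and star_scaleC: "star (c *\<^sub>C x) = cnj c *\<^sub>C star x"
    and star_mult: "star (x * y) = star y * star x"
    and cstar_identity: "norm (star x * x) = (norm x)\<^sup>2"

text \<open>All matrix indices are shifted to start at \<open>0\<close>: the indices of \<open>M\<^sub>m\<close> are \<open>0, \<dots>, m - 1\<close>.\<close>

definition mat_unit :: "nat \<Rightarrow> nat \<Rightarrow> nat \<Rightarrow> complex mat" where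
  "mat_unit m i j = mat m m (\<lambda>(p, q). if p = i \<and> q = j then 1 else 0)"

text \<open>The linear extension of \<open>e\<^sub>i\<^sub>j \<mapsto> (\<Sum>r<l. e\<^bsub>rm+i, rm+j\<^esub>)\<close> from \<open>M\<^sub>m\<close> to \<open>M\<^sub>N\<close>, where \<open>l = N / m\<close>,
  written entrywise because matrices of a given size do not form a type over which one could sum.\<close>

definition std_embedding :: "nat \<Rightarrow> nat \<Rightarrow> complex mat \<Rightarrow> complex mat" where
  "std_embedding m N A = mat N N (\<lambda>pq.
     \<Sum>i<m. \<Sum>j<m. A $$ (i, j) * (\<Sum>r<N div m. mat_unit N (r * m + i) (r * m + j) $$ pq))"

definition unital_star_hom :: "nat \<Rightarrow> (complex mat \<Rightarrow> 'a::cstar_algebra_1) \<Rightarrow> bool" where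
  "unital_star_hom m f \<longleftrightarrow>
     (\<forall>A\<in>carrier_mat m m. \<forall>B\<in>carrier_mat m m. f (A + B) = f A + f B \<and> f (A * B) = f A * f B) \<and>
     (\<forall>A\<in>carrier_mat m m. \<forall>c. f (c \<cdot>\<^sub>m A) = c *\<^sub>C f A) \<and>
     (\<forall>A\<in>carrier_mat m m. f (mat_adjoint A) = star (f A)) \<and>
     f (1\<^sub>m m) = 1"

text \<open>The algebra \<^typ>\<open>'a\<close> with the canonical maps \<open>\<phi> k : M\<^bsub>n k\<^esub> \<rightarrow> 'a\<close> is the C*-inductive limit of the
  system \<open>(M\<^bsub>n k\<^esub>, \<pi>\<^sub>k)\<close>, i.e. the completion of the increasing union of the matrix algebras. No
  condition on norms is needed: an injective *-homomorphism between C*-algebras is isometric, so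
  every \<open>\<phi> k\<close> automatically preserves the operator norm.\<close>

definition uhf_limit :: "(nat \<Rightarrow> nat) \<Rightarrow> (nat \<Rightarrow> complex mat \<Rightarrow> 'a::cstar_algebra_1) \<Rightarrow> bool" where
  "uhf_limit n \<phi> \<longleftrightarrow>
     (\<forall>k. n k > 0 \<and> n k dvd n (Suc k)) \<and>
     (\<forall>k. unital_star_hom (n k) (\<phi> k) \<and> inj_on (\<phi> k) (carrier_mat (n k) (n k))) \<and>
     (\<forall>k. \<forall>A\<in>carrier_mat (n k) (n k). \<phi> (Suc k) (std_embedding (n k) (n (Suc k)) A) = \<phi> k A) \<and>
     closure (\<Union>k. \<phi> k ` carrier_mat (n k) (n k)) = UNIV"

context
  fixes n :: "nat \<Rightarrow> nat" and \<phi> :: "nat \<Rightarrow> complex mat \<Rightarrow> 'a::cstar_algebra_1"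
begin

definition uhf_unit :: "nat \<Rightarrow> nat \<Rightarrow> nat \<Rightarrow> 'a" where
  "uhf_unit k i j = \<phi> k (mat_unit (n k) i j)"

definition uhf_masa :: "'a set" where
  "uhf_masa = closure (\<Union>k. \<phi> k ` {A \<in> carrier_mat (n k) (n k). diagonal_mat A})"

text \<open>Characters are functions on the masa only; outside it they take the value \<^const>\<open>undefined\<close>, so
  that equality of characters is equality on the masa.\<close>

definition uhf_spectrum :: "('a \<Rightarrow> complex) set" where
  "uhf_spectrum = {x \<in> extensional uhf_masa.
     (\<forall>d\<in>uhf_masa. \<forall>f\<in>uhf_masa. x (d + f) = x d + x f \<and> x (d * f) = x d * x f) \<and>
     (\<forall>d\<in>uhf_masa. \<forall>c. x (c *\<^sub>C d) = c * x d) \<and>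
     (\<exists>d\<in>uhf_masa. x d \<noteq> 0)}"

definition uhf_cylinder :: "nat \<Rightarrow> nat \<Rightarrow> ('a \<Rightarrow> complex) set" where
  "uhf_cylinder k i = {x \<in> uhf_spectrum. x (uhf_unit k i i) = 1}"

definition uhf_shift :: "nat \<Rightarrow> nat \<Rightarrow> nat \<Rightarrow> ('a \<Rightarrow> complex) \<Rightarrow> ('a \<Rightarrow> complex)" where
  "uhf_shift k i j y = restrict (\<lambda>d. y (uhf_unit k j i * d * uhf_unit k i j)) uhf_masa"

definition uhf_graph :: "nat \<Rightarrow> nat \<Rightarrow> nat \<Rightarrow> (('a \<Rightarrow> complex) \<times> ('a \<Rightarrow> complex)) set" where
  "uhf_graph k i j = {(uhf_shift k i j y, y) | y. y \<in> uhf_cylinder k j}"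

text \<open>The sets \<open>E\<^sup>k\<^sub>i\<^sub>j\<close> form a base, since any two of them are disjoint or nested; hence the topology
  they generate is the one having them as a base. Its underlying space is the equivalence relation
  \<open>R\<close>, the union of all \<open>E\<^sup>k\<^sub>i\<^sub>j\<close>.\<close>

definition uhf_relation :: "(('a \<Rightarrow> complex) \<times> ('a \<Rightarrow> complex)) topology" where
  "uhf_relation = topology_generated_by {uhf_graph k i j | k i j. i < n k \<and> j < n k}"

definition open_subgraphs :: "(('a \<Rightarrow> complex) \<times> ('a \<Rightarrow> complex)) set set" where
  "open_subgraphs = {P. openin uhf_relation P \<and> Id_on uhf_spectrum \<subseteq> P \<and> sym P}"

definition subgraph_system :: "(('a \<Rightarrow> complex) \<times> ('a \<Rightarrow> complex)) set \<Rightarrow> 'a set" where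
  "subgraph_system P = closure (Modules.module.span (*\<^sub>C)
     {d * uhf_unit k i j * f | d f k i j.
        d \<in> uhf_masa \<and> f \<in> uhf_masa \<and> i < n k \<and> j < n k \<and> uhf_graph k i j \<subseteq> P})"

definition concrete_operator_systems :: "'a set set" where
  "concrete_operator_systems = {S. Modules.module.subspace (*\<^sub>C) S \<and> closed S \<and> star ` S \<subseteq> S \<and>
     uhf_masa \<subseteq> S \<and> (\<forall>d\<in>uhf_masa. \<forall>s\<in>S. \<forall>f\<in>uhf_masa. d * s * f \<in> S)}"

end

end

theory Submission
  imports Defs
begin

text \<open>
  The inverse of \<open>P \<mapsto> S(P)\<close> sends an operator system \<open>S\<close> to the union of the sets \<open>E k i j\<close> with
  \<open>e k i j \<in> S\<close>. Three facts make the two maps mutually inverse.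

  If \<open>e k i j \<in> S(P)\<close>, approximate it within distance \<open>1\<close> by a matrix of some finer level supported on
  \<open>P\<close>: no child of \<open>e k i j\<close> can have coefficient \<open>0\<close>, so \<open>E k i j \<subseteq> P\<close>.

  If \<open>e k i j \<notin> S\<close>, then some child of it is not in \<open>S\<close> either, and so on; the resulting infinite
  branch determines a character, hence a point of \<open>E k i j\<close> in no \<open>E m p q\<close> with \<open>e m p q \<in> S\<close>.

  Finally \<open>S\<close> is the closed span of its matrix units. Let \<open>s \<in> S\<close> be close to a matrix \<open>a\<close> of level \<open>k\<close>
  and much closer, at a scale depending on \<open>k\<close>, to a matrix \<open>b\<close> of a finer level \<open>m\<close>. Pinching by the
  minimal projections of the part of \<open>D\<^sub>m\<close> commuting with level \<open>k\<close> is contractive and fixes \<open>a\<close>, so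
  the pinched \<open>b\<close> is still close to \<open>s\<close>. It has only \<open>(n k)\<^sup>2\<close> blocks that are diagonal up to a
  partial isometry, each with norm the modulus of its largest entry, so its small
  entries may be dropped, while the positions of its large entries carry matrix units that belong
  to \<open>S\<close>.
\<close>

section \<open>Elementary C*-algebra\<close>

interpretation scaleC: vector_space "(*\<^sub>C) :: complex \<Rightarrow> 'a::cstar_algebra_1 \<Rightarrow> 'a"
proof
  show "1 *\<^sub>C x = x" for x :: 'a
    using scaleC_of_real[of 1 x] by simp
qed (simp_all add: scaleC_add_right scaleC_add_left scaleC_scaleC)

lemma bounded_linear_scaleC: "bounded_linear ((*\<^sub>C) c :: 'a::cstar_algebra_1 \<Rightarrow> 'a)"
proof (rule bounded_linear_intro)
  show "c *\<^sub>C (r *\<^sub>R x) = r *\<^sub>R c *\<^sub>C x" for r and x :: 'a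
    by (simp flip: scaleC_of_real add: mult.commute)
  show "norm (c *\<^sub>C x) \<le> norm x * cmod c" for x :: 'a
    by (simp add: norm_scaleC)
qed (rule scaleC_add_right)

lemma star_0 [simp]: "star 0 = (0 :: 'a::cstar_algebra_1)"
  using star_add[of "0::'a" 0] by simp

lemma star_sum: "star (sum f A) = (\<Sum>x\<in>A. star (f x :: 'a::cstar_algebra_1))"
  by (induction A rule: infinite_finite_induct) (auto simp: star_add)

lemma star_1 [simp]: "star 1 = (1 :: 'a::cstar_algebra_1)"
  using star_mult[of "star 1 :: 'a" 1] by (simp add: star_star)

lemma star_minus: "star (- x) = - star (x :: 'a::cstar_algebra_1)"
  using star_add[of x "- x"] by (simp add: eq_neg_iff_add_eq_0 add.commute)

lemma star_diff: "star (x - y) = star x - star (y :: 'a::cstar_algebra_1)"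
  using star_add[of x "- y"] by (simp add: star_minus)

text \<open>The C*-identity and submultiplicativity give \<open>norm x \<le> norm (star x)\<close>;
  applying this to \<open>star x\<close> as well yields equality.\<close>

lemma norm_star: "norm (star x) = norm (x :: 'a::cstar_algebra_1)"
proof -
  have le: "norm x \<le> norm (star x)" for x :: 'a
  proof (cases "x = 0")
    case False
    have "norm x * norm x \<le> norm (star x) * norm x"
      using norm_mult_ineq[of "star x" x] by (simp add: cstar_identity power2_eq_square)
    then show ?thesis using False by simp
  qed simp
  show ?thesis using le[of x] le[of "star x"] by (simp add: star_star)
qed

lemma bounded_linear_star: "bounded_linear (star :: 'a::cstar_algebra_1 \<Rightarrow> 'a)"
proof (rule bounded_linear_intro)
  show "star (r *\<^sub>R x) = r *\<^sub>R star x" for r and x :: 'a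
    using star_scaleC[of "complex_of_real r" x] by (simp add: scaleC_of_real)
  show "norm (star x) \<le> norm x * 1" for x :: 'a
    by (simp add: norm_star)
qed (rule star_add)

lemma norm_projection:
  fixes g :: "'a::cstar_algebra_1"
  assumes "star g = g" "g * g = g"
  shows "norm g \<le> 1"
proof (cases "g = 0")
  case False
  have "norm g * norm g = norm g"
    using cstar_identity[of g] assms by (simp add: power2_eq_square)
  then show ?thesis using False by simp
qed simp

lemma norm_unitary:
  fixes u :: "'a::cstar_algebra_1"
  assumes "star u * u = 1"
  shows "norm u = 1"
  using cstar_identity[of u] assms norm_ge_zero[of u] by (auto simp: power2_eq_1_iff)

section \<open>Closed subspaces and their preimages\<close>

lemma subspace_closure:
  fixes V :: "'a::cstar_algebra_1 set"
  assumes V: "scaleC.subspace V"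
  shows "scaleC.subspace (closure V)"
proof (rule scaleC.subspaceI)
  show "0 \<in> closure V"
    using scaleC.subspace_0[OF V] closure_subset by blast
next
  fix x y assume "x \<in> closure V" "y \<in> closure V"
  then obtain f g where fg: "\<And>i. f i \<in> V" "\<And>i. g i \<in> V" "f \<longlonglongrightarrow> x" "g \<longlonglongrightarrow> y"
    unfolding closure_sequential by blast
  have "(\<lambda>i. f i + g i) \<longlonglongrightarrow> x + y"
    using fg by (intro tendsto_add)
  then show "x + y \<in> closure V"
    unfolding closure_sequential using fg scaleC.subspace_add[OF V] by (metis (no_types, lifting))
next
  fix c x assume "x \<in> closure V"
  then obtain f where f: "\<And>i. f i \<in> V" "f \<longlonglongrightarrow> x"
    unfolding closure_sequential by blast
  have "(\<lambda>i. c *\<^sub>C f i) \<longlonglongrightarrow> c *\<^sub>C x"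
    by (rule bounded_linear.tendsto[OF bounded_linear_scaleC f(2)])
  then show "c *\<^sub>C x \<in> closure V"
    unfolding closure_sequential using f scaleC.subspace_scale[OF V] by (metis (no_types, lifting))
qed

text \<open>Combined with the preimage lemmas below, this reduces a membership statement about a
  closed span to its generators.\<close>

lemma closure_span_minimal:
  fixes V :: "'a::cstar_algebra_1 set"
  assumes "G \<subseteq> V" "scaleC.subspace V" "closed V"
  shows "closure (scaleC.span G) \<subseteq> V"
  using assms by (intro closure_minimal scaleC.span_minimal)

lemma closed_preimage_closed_subspace:
  fixes V :: "'a::cstar_algebra_1 set"
  assumes "bounded_linear h" "closed V"
  shows "closed {x::'a. h x \<in> V}"
  using continuous_closed_vimage[OF assms(2), of h] linear_continuous_at[OF assms(1)]
  by (simp add: vimage_def)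

lemma mult_preimage_subspace:
  fixes V :: "'a::cstar_algebra_1 set"
  assumes "scaleC.subspace V"
  shows "scaleC.subspace {x. a * x * b \<in> V}"
  using assms unfolding scaleC.subspace_def
  by (auto simp: distrib_left distrib_right mult_scaleC_left mult_scaleC_right)

lemma mult_preimage_closed:
  fixes V :: "'a::cstar_algebra_1 set"
  assumes "closed V"
  shows "closed {x. a * x * b \<in> V}"
proof -
  have "bounded_linear (\<lambda>x. a * x * b)"
    by (intro bounded_linear_mult_left[THEN bounded_linear_compose] bounded_linear_mult_right)
  then show ?thesis using assms by (rule closed_preimage_closed_subspace)
qed

lemma star_preimage_subspace:
  fixes V :: "'a::cstar_algebra_1 set"
  assumes "scaleC.subspace V"
  shows "scaleC.subspace {x. star x \<in> V}"
  using assms unfolding scaleC.subspace_def by (auto simp: star_add star_scaleC)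

lemma star_preimage_closed:
  fixes V :: "'a::cstar_algebra_1 set"
  assumes "closed V"
  shows "closed {x. star x \<in> V}"
  using bounded_linear_star assms by (rule closed_preimage_closed_subspace)

section \<open>Norms of diagonal sums and pinchings\<close>

text \<open>By the C*-identity, passing from \<open>x\<close> to \<open>star x * x\<close> squares
  the norm and replaces each coefficient by its squared modulus on the same projections. Iterating
  raises the norm to the power \<open>2 ^ k\<close>, while the factor \<open>card I\<close> of the
  triangle inequality enters only once.\<close>

lemma norm_diagonal_power_le:
  fixes f :: "'i \<Rightarrow> 'a::cstar_algebra_1" and C :: real
  assumes "finite I"
    and proj: "\<And>i. i \<in> I \<Longrightarrow> star (f i) = f i"
    and orth: "\<And>i j. i \<in> I \<Longrightarrow> j \<in> I \<Longrightarrow> f i * f j = (if i = j then f i else 0)"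
    and "\<And>i. i \<in> I \<Longrightarrow> cmod (c i) \<le> C" and "0 \<le> C"
  shows "norm (\<Sum>i\<in>I. c i *\<^sub>C f i) ^ (2 ^ k) \<le> card I * C ^ (2 ^ k)"
  using assms(4,5)
proof (induction k arbitrary: c C)
  case 0
  have "norm (f i) \<le> 1" if "i \<in> I" for i
    using norm_projection[of "f i"] proj orth that by auto
  then have "norm (c i *\<^sub>C f i) \<le> C" if "i \<in> I" for i
    using 0 that mult_mono[of "cmod (c i)" C "norm (f i)" 1] by (auto simp: norm_scaleC)
  then have "norm (\<Sum>i\<in>I. c i *\<^sub>C f i) \<le> (\<Sum>i\<in>I. C)"
    by (intro sum_norm_le) auto
  then show ?case by simp
next
  case (Suc k)
  let ?x = "\<Sum>i\<in>I. c i *\<^sub>C f i"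
  have "star ?x * ?x = (\<Sum>i\<in>I. \<Sum>j\<in>I. (c j * cnj (c i)) *\<^sub>C (f i * f j))"
    by (simp add: star_sum star_scaleC proj sum_product mult_scaleC_left mult_scaleC_right cong: sum.cong)
  also have "\<dots> = (\<Sum>i\<in>I. \<Sum>j\<in>I. if i = j then (c j * cnj (c i)) *\<^sub>C f i else 0)"
    by (intro sum.cong refl) (simp add: orth)
  also have "\<dots> = (\<Sum>i\<in>I. (c i * cnj (c i)) *\<^sub>C f i)"
    using \<open>finite I\<close> by (simp cong: sum.cong)
  finally have x: "norm (\<Sum>i\<in>I. (c i * cnj (c i)) *\<^sub>C f i) = (norm ?x)\<^sup>2"
    using cstar_identity[of ?x] by simp
  have "norm (\<Sum>i\<in>I. (c i * cnj (c i)) *\<^sub>C f i) ^ (2 ^ k) \<le> card I * (C\<^sup>2) ^ (2 ^ k)"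
    using Suc.prems by (intro Suc.IH) (auto simp: norm_mult power2_eq_square intro!: mult_mono)
  then show ?case
    by (simp add: x flip: power_mult)
qed

text \<open>If the norm \<open>y\<close> exceeded \<open>C\<close>, the powers of
  \<open>y / C\<close> would be unbounded, yet the previous lemma bounds infinitely many of them by
  \<open>card I\<close>.\<close>

lemma norm_diagonal_le:
  fixes f :: "'i \<Rightarrow> 'a::cstar_algebra_1" and C :: real
  assumes "finite I"
    and "\<And>i. i \<in> I \<Longrightarrow> star (f i) = f i"
    and "\<And>i j. i \<in> I \<Longrightarrow> j \<in> I \<Longrightarrow> f i * f j = (if i = j then f i else 0)"
    and "\<And>i. i \<in> I \<Longrightarrow> cmod (c i) \<le> C" and C: "0 \<le> C"
  shows "norm (\<Sum>i\<in>I. c i *\<^sub>C f i) \<le> C"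
proof (rule ccontr)
  assume "\<not> ?thesis"
  moreover define y where "y = norm (\<Sum>i\<in>I. c i *\<^sub>C f i)"
  ultimately have y: "C < y" by simp
  have b: "y ^ (2 ^ k) \<le> card I * C ^ (2 ^ k)" for k
    unfolding y_def by (rule norm_diagonal_power_le) (use assms in auto)
  show False
  proof (cases "C = 0")
    case True
    then show False using b[of 0] y by simp
  next
    case False
    then have C: "0 < C" "1 < y / C" using C y by auto
    obtain k where k: "real (card I) < (y / C) ^ k"
      using real_arch_pow[OF C(2)] by blast
    also have "\<dots> \<le> (y / C) ^ (2 ^ k)"
      using C(2) by (intro power_increasing) (auto intro: less_imp_le)
    finally show False
      using b[of k] C by (simp add: power_divide field_simps)
  qed
qed

text \<open>Pinching by one projection \<open>g\<close> is the average of \<open>a\<close> and \<open>u a u\<close> for the unitary \<open>u = 2g - 1\<close>.\<close>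

lemma norm_pinching_projection:
  fixes g a :: "'a::cstar_algebra_1"
  assumes g: "star g = g" "g * g = g"
  shows "norm (g * a * g + (1 - g) * a * (1 - g)) \<le> norm a"
proof -
  define u where "u = 2 * g - 1"
  have u: "star u = u" "u * u = 1"
    using g by (auto simp: u_def star_diff star_add algebra_simps mult_2 mult_2_right)
  then have "norm u = 1" by (intro norm_unitary) simp
  then have "norm (u * a * u) \<le> norm a"
    using norm_mult_ineq[of "u * a" u] norm_mult_ineq[of u a] by simp
  then have "norm (a + u * a * u) \<le> 2 * norm a"
    using norm_triangle_ineq[of a "u * a * u"] by simp
  moreover have "a + u * a * u = 2 *\<^sub>R (g * a * g + (1 - g) * a * (1 - g))"
    by (simp add: u_def algebra_simps mult_2 mult_2_right scaleR_2)
  ultimately show ?thesis by simp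
qed

text \<open>The projections are split off one at a time, the remainder
  \<open>1 - (\<Sum>r<R. g r)\<close> serving as one more block; for \<open>R = N\<close> it
  vanishes.\<close>

lemma norm_pinching_partial:
  fixes g :: "nat \<Rightarrow> 'a::cstar_algebra_1"
  assumes proj: "\<And>r. r < N \<Longrightarrow> star (g r) = g r"
    and orth: "\<And>r t. r < N \<Longrightarrow> t < N \<Longrightarrow> g r * g t = (if r = t then g r else 0)"
  shows "R \<le> N \<Longrightarrow> norm ((\<Sum>r<R. g r * a * g r) + (1 - (\<Sum>r<R. g r)) * a * (1 - (\<Sum>r<R. g r))) \<le> norm a"
proof (induction R)
  case (Suc R)
  define h where "h = 1 - (\<Sum>r<R. g r)"
  define A where "A = (\<Sum>r<R. g r * a * g r)"
  define b where "b = A + h * a * h"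
  have gg: "g R * g R = g R" using orth Suc.prems by simp
  have sl: "g R * (\<Sum>r<R. g r) = 0" and sr: "(\<Sum>r<R. g r) * g R = 0"
    using Suc.prems by (auto simp: sum_distrib_left sum_distrib_right orth intro!: sum.neutral)
  have h: "g R * h = g R" "h * g R = g R" by (simp_all add: h_def algebra_simps sl sr)
  have A: "g R * A = 0" "A * g R = 0"
    using Suc.prems
    by (auto simp: A_def sum_distrib_left sum_distrib_right orth mult.assoc intro!: sum.neutral)
      (simp flip: mult.assoc add: orth)
  have b1: "g R * b = g R * a * h" "b * g R = h * a * g R"
    by (simp_all add: b_def distrib_left distrib_right A h mult.assoc) (simp flip: mult.assoc add: h)
  \<comment> \<open>\<open>g R\<close> annihilates \<open>A\<close> and lies below \<open>h\<close>,
    so pinching \<open>b\<close> by \<open>g R\<close> leaves \<open>A\<close> alone and splits only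
    the corner \<open>h * a * h\<close>.\<close>
  have "g R * b * g R + (1 - g R) * b * (1 - g R) = A + g R * a * g R + (h - g R) * a * (h - g R)"
    by (simp add: algebra_simps b1 h) (simp add: b_def algebra_simps h gg b1 flip: mult.assoc)
  moreover have "norm (g R * b * g R + (1 - g R) * b * (1 - g R)) \<le> norm b"
    using proj Suc.prems by (intro norm_pinching_projection gg) auto
  moreover have "norm b \<le> norm a"
    using Suc by (simp add: b_def A_def h_def)
  moreover have "1 - (\<Sum>r<Suc R. g r) = h - g R"
    by (simp add: h_def)
  moreover have "(\<Sum>r<Suc R. g r * a * g r) = A + g R * a * g R"
    by (simp add: A_def)
  ultimately show ?case
    by (simp only:)
qed simp

lemma norm_pinching:
  fixes g :: "nat \<Rightarrow> 'a::cstar_algebra_1"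
  assumes "\<And>r. r < N \<Longrightarrow> star (g r) = g r"
    and "\<And>r t. r < N \<Longrightarrow> t < N \<Longrightarrow> g r * g t = (if r = t then g r else 0)"
    and "(\<Sum>r<N. g r) = 1"
  shows "norm (\<Sum>r<N. g r * a * g r) \<le> norm a"
  using norm_pinching_partial[of N g N a] assms by simp

text \<open>Membership at all large levels is stable under sums, because two elements can be
  compared at the larger of their two thresholds.\<close>

lemma subspace_eventually:
  fixes V :: "nat \<Rightarrow> 'a::cstar_algebra_1 set"
  assumes "\<And>m. scaleC.subspace (V m)"
  shows "scaleC.subspace {a. \<exists>k. \<forall>m\<ge>k. a \<in> V m}"
proof (rule scaleC.subspaceI; safe?)
  show "\<exists>k. \<forall>m\<ge>k. 0 \<in> V m"
    using assms scaleC.subspace_0 by blast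
next
  fix x y k l assume "\<forall>m\<ge>k. x \<in> V m" "\<forall>m\<ge>l. y \<in> V m"
  then show "\<exists>k. \<forall>m\<ge>k. x + y \<in> V m"
    using scaleC.subspace_add[OF assms] by (intro exI[of _ "max k l"]) auto
next
  fix c x k assume "\<forall>m\<ge>k. x \<in> V m"
  then show "\<exists>k. \<forall>m\<ge>k. c *\<^sub>C x \<in> V m"
    using assms scaleC.subspace_scale by blast
qed

section \<open>Approximate eigenvalues along a sequence of norm-one elements\<close>

text \<open>\<open>c *\<^sub>C f t\<close> has norm \<open>cmod c\<close> and differs by a null
  sequence from \<open>f t * d\<close>, whose norm is at most \<open>norm d\<close>. Applied to
  differences, this makes the eigenvalue unique and a contractive function of
  \<open>d\<close>.\<close>

lemma approx_eigen_norm_le: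
  fixes f :: "nat \<Rightarrow> 'a::cstar_algebra_1"
  assumes f: "\<And>t. norm (f t) = 1" and lim: "(\<lambda>t. f t * d - c *\<^sub>C f t) \<longlonglongrightarrow> 0"
  shows "cmod c \<le> norm d"
proof (rule LIMSEQ_le_const[where X = "\<lambda>t. norm d + norm (f t * d - c *\<^sub>C f t)"])
  show "(\<lambda>t. norm d + norm (f t * d - c *\<^sub>C f t)) \<longlonglongrightarrow> norm d"
    using tendsto_add[OF tendsto_const tendsto_norm[OF lim], of "norm d"] by simp
  have "cmod c \<le> norm d + norm (f t * d - c *\<^sub>C f t)" for t
  proof -
    have "norm (c *\<^sub>C f t) \<le> norm (f t * d) + norm (f t * d - c *\<^sub>C f t)"
      using norm_triangle_ineq4[of "f t * d" "f t * d - c *\<^sub>C f t"] by simp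
    moreover have "norm (f t * d) \<le> norm d"
      using norm_mult_ineq[of "f t" d] by (simp add: f)
    ultimately show ?thesis by (simp add: norm_scaleC f)
  qed
  then show "\<exists>N. \<forall>t\<ge>N. cmod c \<le> norm d + norm (f t * d - c *\<^sub>C f t)" by blast
qed

lemma approx_eigen_add:
  fixes f :: "nat \<Rightarrow> 'a::cstar_algebra_1"
  assumes "(\<lambda>t. f t * d - c *\<^sub>C f t) \<longlonglongrightarrow> 0" "(\<lambda>t. f t * d' - c' *\<^sub>C f t) \<longlonglongrightarrow> 0"
  shows "(\<lambda>t. f t * (d + d') - (c + c') *\<^sub>C f t) \<longlonglongrightarrow> 0"
proof -
  have "(\<lambda>t. f t * (d + d') - (c + c') *\<^sub>C f t) = (\<lambda>t. (f t * d - c *\<^sub>C f t) + (f t * d' - c' *\<^sub>C f t))"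
    by (simp add: distrib_left scaleC_add_left algebra_simps)
  then show ?thesis using tendsto_add[OF assms] by simp
qed

lemma approx_eigen_scale:
  fixes f :: "nat \<Rightarrow> 'a::cstar_algebra_1"
  assumes "(\<lambda>t. f t * d - c *\<^sub>C f t) \<longlonglongrightarrow> 0"
  shows "(\<lambda>t. f t * (a *\<^sub>C d) - (a * c) *\<^sub>C f t) \<longlonglongrightarrow> 0"
proof -
  have "(\<lambda>t. f t * (a *\<^sub>C d) - (a * c) *\<^sub>C f t) = (\<lambda>t. a *\<^sub>C (f t * d - c *\<^sub>C f t))"
    by (simp add: mult_scaleC_right scaleC.scale_right_diff_distrib)
  then show ?thesis using bounded_linear.tendsto[OF bounded_linear_scaleC assms, of a] by simp
qed

lemma approx_eigen_mult:
  fixes f :: "nat \<Rightarrow> 'a::cstar_algebra_1"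
  assumes "(\<lambda>t. f t * d - c *\<^sub>C f t) \<longlonglongrightarrow> 0" "(\<lambda>t. f t * d' - c' *\<^sub>C f t) \<longlonglongrightarrow> 0"
  shows "(\<lambda>t. f t * (d * d') - (c * c') *\<^sub>C f t) \<longlonglongrightarrow> 0"
proof -
  have "(\<lambda>t. f t * (d * d') - (c * c') *\<^sub>C f t) =
      (\<lambda>t. (f t * d - c *\<^sub>C f t) * d' + c *\<^sub>C (f t * d' - c' *\<^sub>C f t))"
    by (simp add: left_diff_distrib mult_scaleC_left scaleC.scale_right_diff_distrib mult.assoc)
  then show ?thesis
    using tendsto_add[OF tendsto_mult_left_zero[OF assms(1), of d']
        bounded_linear.tendsto[OF bounded_linear_scaleC assms(2), of c]] by simp
qed

text \<open>\<open>c - c'\<close> is an approximate eigenvalue of \<open>d - d = 0\<close>, hence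
  bounded by 0.\<close>

lemma approx_eigen_unique:
  fixes f :: "nat \<Rightarrow> 'a::cstar_algebra_1"
  assumes "\<And>t. norm (f t) = 1" "(\<lambda>t. f t * d - c *\<^sub>C f t) \<longlonglongrightarrow> 0" "(\<lambda>t. f t * d - c' *\<^sub>C f t) \<longlonglongrightarrow> 0"
  shows "c = c'"
proof -
  have "(\<lambda>t. f t * (d + (-1) *\<^sub>C d) - (c + (-1) * c') *\<^sub>C f t) \<longlonglongrightarrow> 0"
    using approx_eigen_add[OF assms(2) approx_eigen_scale[OF assms(3)]] .
  from approx_eigen_norm_le[OF assms(1) this] show ?thesis
    using scaleC.scale_minus_left[of 1 d] by simp
qed

lemma approx_eigen_subspace:
  fixes f :: "nat \<Rightarrow> 'a::cstar_algebra_1"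
  shows "scaleC.subspace {d. \<exists>c. (\<lambda>t. f t * d - c *\<^sub>C f t) \<longlonglongrightarrow> 0}"
proof (rule scaleC.subspaceI)
  show "0 \<in> {d. \<exists>c. (\<lambda>t. f t * d - c *\<^sub>C f t) \<longlonglongrightarrow> 0}"
    by (intro CollectI exI[of _ 0]) simp
qed (auto dest: approx_eigen_add approx_eigen_scale)

text \<open>The eigenvalues of a convergent sequence are Cauchy by contractivity; their limit is an
  eigenvalue of the limit element by an \<epsilon>/3 argument.\<close>

lemma approx_eigen_closed:
  fixes f :: "nat \<Rightarrow> 'a::cstar_algebra_1"
  assumes f: "\<And>t. norm (f t) = 1"
  shows "closed {d. \<exists>c. (\<lambda>t. f t * d - c *\<^sub>C f t) \<longlonglongrightarrow> 0}"
  unfolding closed_sequential_limits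
proof (intro allI impI, elim conjE)
  fix x d assume x: "\<forall>s. x s \<in> {d. \<exists>c. (\<lambda>t. f t * d - c *\<^sub>C f t) \<longlonglongrightarrow> 0}" and d: "x \<longlonglongrightarrow> d"
  from x have "\<forall>s. \<exists>c. (\<lambda>t. f t * x s - c *\<^sub>C f t) \<longlonglongrightarrow> 0" by simp
  from choice[OF this] obtain c where c: "\<And>s. (\<lambda>t. f t * x s - c s *\<^sub>C f t) \<longlonglongrightarrow> 0" by blast
  have le: "cmod (c s - c s') \<le> norm (x s - x s')" for s s'
  proof -
    have "(\<lambda>t. f t * (x s + (-1) *\<^sub>C x s') - (c s + (-1) * c s') *\<^sub>C f t) \<longlonglongrightarrow> 0"
      using approx_eigen_add[OF c approx_eigen_scale[OF c]] .
    from approx_eigen_norm_le[OF f this] show ?thesis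
      using scaleC.scale_minus_left[of 1 "x s'"] by simp
  qed
  have "Cauchy c"
  proof (rule metric_CauchyI)
    fix \<epsilon> :: real assume "0 < \<epsilon>"
    then obtain N where "\<forall>s\<ge>N. \<forall>s'\<ge>N. dist (x s) (x s') < \<epsilon>"
      using LIMSEQ_imp_Cauchy[OF d] unfolding Cauchy_def by blast
    then show "\<exists>N. \<forall>s\<ge>N. \<forall>s'\<ge>N. dist (c s) (c s') < \<epsilon>"
      using le by (metis dist_norm le_less_trans)
  qed
  then obtain c0 where c0: "c \<longlonglongrightarrow> c0"
    using Cauchy_convergent convergentD by blast
  have "(\<lambda>t. f t * d - c0 *\<^sub>C f t) \<longlonglongrightarrow> 0"
  proof (rule metric_LIMSEQ_I)
    fix \<epsilon> :: real assume "0 < \<epsilon>"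
    then have \<epsilon>: "0 < \<epsilon> / 3" by simp
    obtain s where s: "norm (x s - d) < \<epsilon> / 3" "cmod (c s - c0) < \<epsilon> / 3"
    proof -
      obtain N1 where "\<forall>s\<ge>N1. norm (x s - d) < \<epsilon> / 3" using LIMSEQ_D[OF d \<epsilon>] by blast
      moreover obtain N2 where "\<forall>s\<ge>N2. cmod (c s - c0) < \<epsilon> / 3" using LIMSEQ_D[OF c0 \<epsilon>] by blast
      ultimately show thesis using that[of "max N1 N2"] by simp
    qed
    obtain N where N: "\<And>t. t \<ge> N \<Longrightarrow> norm (f t * x s - c s *\<^sub>C f t) < \<epsilon> / 3"
      using LIMSEQ_D[OF c \<epsilon>] by fastforce
    have "norm (f t * d - c0 *\<^sub>C f t) < \<epsilon>" if "t \<ge> N" for t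
    proof -
      have "f t * d - c0 *\<^sub>C f t = (f t * x s - c s *\<^sub>C f t) - f t * (x s - d) + (c s - c0) *\<^sub>C f t"
        by (simp add: right_diff_distrib scaleC.scale_left_diff_distrib)
      also have "norm \<dots> \<le> norm (f t * x s - c s *\<^sub>C f t) + norm (f t * (x s - d)) + norm ((c s - c0) *\<^sub>C f t)"
        by (rule order_trans[OF norm_triangle_ineq add_right_mono[OF norm_triangle_ineq4]])
      also have "\<dots> < \<epsilon> / 3 + \<epsilon> / 3 + \<epsilon> / 3"
        using N[OF that] s norm_mult_ineq[of "f t" "x s - d"] by (simp add: norm_scaleC f)
      finally show ?thesis by simp
    qed
    then show "\<exists>N. \<forall>t\<ge>N. dist (f t * d - c0 *\<^sub>C f t) 0 < \<epsilon>" by auto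
  qed
  then show "d \<in> {d. \<exists>c. (\<lambda>t. f t * d - c *\<^sub>C f t) \<longlonglongrightarrow> 0}" by blast
qed

section \<open>The matrix units of a UHF algebra\<close>

text \<open>Matrices of a fixed size are not a type over which to sum, so additivity is applied one
  entry at a time, by induction on the set \<open>F\<close> of entries kept.\<close>

lemma unital_star_hom_expansion:
  fixes f :: "complex mat \<Rightarrow> 'a::cstar_algebra_1"
  assumes f: "unital_star_hom m f" and A: "A \<in> carrier_mat m m"
  shows "f A = (\<Sum>i<m. \<Sum>j<m. A $$ (i, j) *\<^sub>C f (mat_unit m i j))"
proof -
  have add: "f (B + C) = f B + f C" if "B \<in> carrier_mat m m" "C \<in> carrier_mat m m" for B C
    using f that unfolding unital_star_hom_def by auto
  have scale: "f (c \<cdot>\<^sub>m B) = c *\<^sub>C f B" if "B \<in> carrier_mat m m" for B c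
    using f that unfolding unital_star_hom_def by auto
  have partial: "f (mat m m (\<lambda>pq. if pq \<in> F then A $$ pq else 0)) = (\<Sum>(p, q)\<in>F. A $$ (p, q) *\<^sub>C f (mat_unit m p q))"
    if "finite F" "F \<subseteq> {..<m} \<times> {..<m}" for F
    using that
  proof (induction F)
    case empty
    \<comment> \<open>Writing the zero matrix as a zero multiple lets homogeneity of
      \<open>f\<close> give the value 0.\<close>
    have "mat m m (\<lambda>pq. if pq \<in> {} then A $$ pq else 0) = 0 \<cdot>\<^sub>m 1\<^sub>m m"
      by (rule eq_matI) auto
    then show ?case using scale[of "1\<^sub>m m" 0] by simp
  next
    case (insert z F)
    obtain p q where z: "z = (p, q)" by force
    have "mat m m (\<lambda>pq. if pq \<in> insert z F then A $$ pq else 0) =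
        (A $$ z) \<cdot>\<^sub>m mat_unit m p q + mat m m (\<lambda>pq. if pq \<in> F then A $$ pq else 0)"
      using insert.hyps by (intro eq_matI) (auto simp: mat_unit_def z)
    then show ?case
      using insert scale[of "mat_unit m p q" "A $$ z"]
        add[of "(A $$ z) \<cdot>\<^sub>m mat_unit m p q" "mat m m (\<lambda>pq. if pq \<in> F then A $$ pq else 0)"]
      by (simp add: z mat_unit_def)
  qed
  have "mat m m (\<lambda>pq. if pq \<in> {..<m} \<times> {..<m} then A $$ pq else 0) = A"
    using A by (intro eq_matI) auto
  then show ?thesis
    using partial[of "{..<m} \<times> {..<m}"] by (simp add: sum.cartesian_product)
qed

lemma mat_unit_carrier: "mat_unit m i j \<in> carrier_mat m m"
  by (simp add: mat_unit_def)

text \<open>The vanishing product is written as a zero multiple of a matrix unit, which homogeneity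
  of a homomorphism sends to 0.\<close>

lemma mat_unit_mult:
  assumes "j < m" "p < m"
  shows "mat_unit m i j * mat_unit m p q = (if j = p then mat_unit m i q else 0 \<cdot>\<^sub>m mat_unit m i q)"
proof (rule eq_matI)
  fix a b assume "a < dim_row (if j = p then mat_unit m i q else 0 \<cdot>\<^sub>m mat_unit m i q)"
    and "b < dim_col (if j = p then mat_unit m i q else 0 \<cdot>\<^sub>m mat_unit m i q)"
  then have ab: "a < m" "b < m" by (auto simp: mat_unit_def split: if_splits)
  have "(mat_unit m i j * mat_unit m p q) $$ (a, b) =
      (\<Sum>c<m. (if a = i \<and> c = j then 1 else 0) * (if c = p \<and> b = q then 1 else 0))"
    using ab by (simp add: mat_unit_def scalar_prod_def atLeast0LessThan)
  also have "\<dots> = (\<Sum>c<m. if c = j then (if a = i \<and> j = p \<and> b = q then 1 else 0) else 0)"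
    by (intro sum.cong) auto
  also have "\<dots> = (if a = i \<and> j = p \<and> b = q then 1 else 0)"
    using assms by simp
  finally show "(mat_unit m i j * mat_unit m p q) $$ (a, b) =
      (if j = p then mat_unit m i q else 0 \<cdot>\<^sub>m mat_unit m i q) $$ (a, b)"
    using ab by (auto simp: mat_unit_def)
qed (auto simp: mat_unit_def)

lemma mat_adjoint_mat_unit: "mat_adjoint (mat_unit m i j) = mat_unit m j i"
  by (rule eq_matI) (auto simp: mat_adjoint_def mat_unit_def mat_of_rows_index)

lemma sum_lessThan_mult:
  fixes f :: "nat \<Rightarrow> 'b::comm_monoid_add"
  shows "(\<Sum>t<a. \<Sum>r<b. f (t * b + r)) = (\<Sum>q<a * b. f q)"
proof -
  have "(\<Sum>r<b. f (t * b + r)) = sum f {t * b..<t * b + b}" for t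
    using sum.shift_bounds_nat_ivl[of f 0 "t * b" b] by (simp add: lessThan_atLeast0 add.commute)
  then show ?thesis by (simp add: sum.nat_group)
qed

locale uhf_algebra =
  fixes n :: "nat \<Rightarrow> nat" and \<phi> :: "nat \<Rightarrow> complex mat \<Rightarrow> 'a::cstar_algebra_1"
  assumes uhf: "uhf_limit n \<phi>"
begin

abbreviation e :: "nat \<Rightarrow> nat \<Rightarrow> nat \<Rightarrow> 'a" where "e \<equiv> uhf_unit n \<phi>"
abbreviation D :: "'a set" where "D \<equiv> uhf_masa n \<phi>"

section \<open>Index arithmetic between levels\<close>

lemma n_pos: "n k > 0"
  using uhf by (simp add: uhf_limit_def)

lemma n_dvd: "k \<le> m \<Longrightarrow> n k dvd n m"
proof (induction rule: dec_induct)
  case (step m)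
  then show ?case using uhf dvd_trans unfolding uhf_limit_def by blast
qed simp

lemma n_mult_div: "k \<le> m \<Longrightarrow> n m div n k * n k = n m"
  by (simp add: n_dvd)

text \<open>An index \<open>p\<close> of level \<open>m\<close> descends from the index
  \<open>p mod n k\<close> of level \<open>k\<close> and is its child number
  \<open>p div n k\<close>; conversely child \<open>r\<close> of \<open>i\<close> is
  \<open>r * n k + i\<close>.\<close>

lemma child_less:
  assumes "k \<le> m" "r < n m div n k" "i < n k"
  shows "r * n k + i < n m"
proof -
  have "r * n k + i < Suc r * n k" using assms by simp
  also have "\<dots> \<le> n m div n k * n k" using assms by (intro mult_le_mono1) simp
  finally show ?thesis using assms by (simp add: n_mult_div)
qed

lemma div_less_levels: "k \<le> m \<Longrightarrow> p < n m \<Longrightarrow> p div n k < n m div n k"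
  by (simp add: less_mult_imp_div_less n_mult_div)

lemma mod_less_level: "p mod n k < n k"
  by (simp add: n_pos)

lemma child_div_mod [simp]:
  "i < n k \<Longrightarrow> (r * n k + i) div n k = r" "i < n k \<Longrightarrow> (r * n k + i) mod n k = i"
  by simp_all

lemma sum_levels:
  fixes f :: "nat \<Rightarrow> 'b::comm_monoid_add"
  assumes "k \<le> m"
  shows "(\<Sum>p<n m. f p) = (\<Sum>r<n m div n k. \<Sum>i<n k. f (r * n k + i))"
  using assms by (simp add: sum_lessThan_mult n_mult_div)

section \<open>Relations among the matrix units of the limit\<close>

lemma hom: "unital_star_hom (n k) (\<phi> k)"
  using uhf by (simp add: uhf_limit_def)

lemma phi_expansion:
  assumes "A \<in> carrier_mat (n k) (n k)"
  shows "\<phi> k A = (\<Sum>i<n k. \<Sum>j<n k. A $$ (i, j) *\<^sub>C e k i j)"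
  using unital_star_hom_expansion[OF hom assms] by (simp add: uhf_unit_def)

lemma e_mult:
  assumes "j < n k" "p < n k"
  shows "e k i j * e k p q = (if j = p then e k i q else 0)"
proof -
  have "e k i j * e k p q = \<phi> k (mat_unit (n k) i j * mat_unit (n k) p q)"
    using hom[of k] mat_unit_carrier unfolding uhf_unit_def unital_star_hom_def by simp
  also have "\<dots> = (if j = p then e k i q else \<phi> k (0 \<cdot>\<^sub>m mat_unit (n k) i q))"
    using assms by (simp add: mat_unit_mult uhf_unit_def)
  also have "\<phi> k (0 \<cdot>\<^sub>m mat_unit (n k) i q) = 0"
    using hom[of k] mat_unit_carrier unfolding unital_star_hom_def by simp
  finally show ?thesis .
qed

lemma star_e: "star (e k i j) = e k j i"
  using hom[of k] mat_unit_carrier unfolding uhf_unit_def unital_star_hom_def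
  by (metis mat_adjoint_mat_unit)

lemma sum_e: "(\<Sum>i<n k. e k i i) = 1"
proof -
  have "1 = \<phi> k (1\<^sub>m (n k))"
    using hom[of k] by (simp add: unital_star_hom_def)
  also have "\<dots> = (\<Sum>i<n k. \<Sum>j<n k. if i = j then e k i j else 0)"
    by (subst phi_expansion) (auto simp: if_distrib[of "\<lambda>c. c *\<^sub>C _"] cong: if_cong intro!: sum.cong)
  finally show ?thesis by simp
qed

lemma e_nonzero:
  assumes "i < n k" "j < n k"
  shows "e k i j \<noteq> 0"
proof
  assume "e k i j = 0"
  moreover have "\<phi> k (0 \<cdot>\<^sub>m mat_unit (n k) i j) = 0"
    using hom[of k] mat_unit_carrier unfolding unital_star_hom_def by simp
  moreover have "inj_on (\<phi> k) (carrier_mat (n k) (n k))"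
    using uhf by (simp add: uhf_limit_def)
  ultimately have "mat_unit (n k) i j = 0 \<cdot>\<^sub>m mat_unit (n k) i j"
    unfolding uhf_unit_def by (metis inj_onD mat_unit_carrier smult_carrier_mat)
  then have "mat_unit (n k) i j $$ (i, j) = (0 \<cdot>\<^sub>m mat_unit (n k) i j) $$ (i, j)"
    by simp
  then show False using assms by (simp add: mat_unit_def)
qed

lemma norm_e:
  assumes "i < n k" "j < n k"
  shows "norm (e k i j) = 1"
proof -
  have "norm (e k j j) \<noteq> 0" using assms e_nonzero by simp
  moreover have "norm (e k j j) = norm (e k j j) ^ 2"
    using cstar_identity[of "e k j j"] assms by (simp add: star_e e_mult)
  ultimately have "norm (e k j j) = 1" by (simp add: power2_eq_square)
  then have "(norm (e k i j))\<^sup>2 = 1"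
    using cstar_identity[of "e k i j"] assms by (simp add: star_e e_mult)
  then show ?thesis using norm_ge_zero[of "e k i j"] by (auto simp: power2_eq_1_iff)
qed

text \<open>Compatibility of the maps \<open>\<phi> k\<close> with \<open>std_embedding\<close>,
  read in the limit algebra; the work lies in computing the entries of the embedded matrix
  unit.\<close>

lemma e_refine_Suc:
  assumes "i < n k" "j < n k"
  shows "e k i j = (\<Sum>r<n (Suc k) div n k. e (Suc k) (r * n k + i) (r * n k + j))"
proof -
  let ?N = "n (Suc k)" and ?E = "std_embedding (n k) (n (Suc k)) (mat_unit (n k) i j)"
  have carrier: "?E \<in> carrier_mat ?N ?N"
    by (simp add: std_embedding_def)
  have entry: "?E $$ (p, q) = (\<Sum>r<?N div n k. if p = r * n k + i \<and> q = r * n k + j then 1 else 0)"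
    if "p < ?N" "q < ?N" for p q
  proof -
    have "?E $$ (p, q) = (\<Sum>a<n k. \<Sum>b<n k. mat_unit (n k) i j $$ (a, b) *
        (\<Sum>r<?N div n k. mat_unit ?N (r * n k + a) (r * n k + b) $$ (p, q)))"
      using that by (simp add: std_embedding_def)
    \<comment> \<open>Nested conditionals, innermost summation index first, let both sums collapse
      by the delta rule.\<close>
    also have "\<dots> = (\<Sum>a<n k. \<Sum>b<n k. if b = j then if a = i then
        (\<Sum>r<?N div n k. mat_unit ?N (r * n k + i) (r * n k + j) $$ (p, q)) else 0 else 0)"
      by (intro sum.cong refl) (auto simp: mat_unit_def)
    also have "\<dots> = (\<Sum>r<?N div n k. mat_unit ?N (r * n k + i) (r * n k + j) $$ (p, q))"
      using assms by simp
    finally show ?thesis using that by (simp add: mat_unit_def)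
  qed
  have "e k i j = \<phi> (Suc k) ?E"
    using uhf mat_unit_carrier unfolding uhf_limit_def uhf_unit_def by metis
  also have "\<dots> = (\<Sum>p<?N. \<Sum>q<?N. \<Sum>r<?N div n k.
      if p = r * n k + i \<and> q = r * n k + j then e (Suc k) (r * n k + i) (r * n k + j) else 0)"
    by (subst phi_expansion)
      (auto simp: entry scaleC.scale_sum_left if_distrib[of "\<lambda>c. c *\<^sub>C _"] carrier cong: if_cong
        intro!: sum.cong)
  also have "\<dots> = (\<Sum>r<?N div n k. \<Sum>p<?N. \<Sum>q<?N.
      if p = r * n k + i \<and> q = r * n k + j then e (Suc k) (r * n k + i) (r * n k + j) else 0)"
    by (simp add: sum.swap[of _ "{..<?N div n k}"])
  also have "\<dots> = (\<Sum>r<?N div n k. \<Sum>p<?N. \<Sum>q<?N. if q = r * n k + j then if p = r * n k + i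
      then e (Suc k) (r * n k + i) (r * n k + j) else 0 else 0)"
    by (intro sum.cong refl) auto
  also have "\<dots> = (\<Sum>r<?N div n k. e (Suc k) (r * n k + i) (r * n k + j))"
    using assms child_less[of k "Suc k"] by (intro sum.cong) auto
  finally show ?thesis .
qed

text \<open>Iterates the one-step refinement: child \<open>t\<close> of child \<open>r\<close> is
  child number \<open>t * (n m div n k) + r\<close> relative to level \<open>k\<close>.\<close>

lemma e_refine:
  assumes "k \<le> m" "i < n k" "j < n k"
  shows "e k i j = (\<Sum>r<n m div n k. e m (r * n k + i) (r * n k + j))"
  using assms(1)
proof (induction rule: dec_induct)
  case base
  then show ?case using n_pos[of k] by simp
next
  case (step m)
  let ?N = "n (Suc m)"
  have "e k i j = (\<Sum>r<n m div n k. \<Sum>t<?N div n m. e (Suc m) (t * n m + (r * n k + i)) (t * n m + (r * n k + j)))"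
    unfolding step.IH using step assms
    by (intro sum.cong refl e_refine_Suc child_less) auto
  also have "\<dots> = (\<Sum>t<?N div n m. \<Sum>r<n m div n k.
      e (Suc m) ((t * (n m div n k) + r) * n k + i) ((t * (n m div n k) + r) * n k + j))"
    using n_mult_div[of k m] step(1)
    by (subst sum.swap) (simp add: distrib_right add.assoc mult.assoc)
  also have "\<dots> = (\<Sum>q<?N div n m * (n m div n k). e (Suc m) (q * n k + i) (q * n k + j))"
    by (rule sum_lessThan_mult)
  also have "?N div n m * (n m div n k) = ?N div n k"
    using step(1) by (simp add: div_mult_swap n_dvd)
  finally show ?case .
qed

text \<open>Of the children of \<open>e k i j\<close>, only the one numbered
  \<open>p div n k\<close> can have column \<open>p\<close>, and it does so exactly when
  \<open>p\<close> descends from \<open>j\<close>.\<close>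

lemma e_mult_fine:
  assumes "k \<le> m" "i < n k" "j < n k" "p < n m" "q < n m"
  shows "e k i j * e m p q = (if p mod n k = j then e m (p div n k * n k + i) q else 0)"
proof -
  have "e k i j * e m p q = (\<Sum>r<n m div n k. e m (r * n k + i) (r * n k + j) * e m p q)"
    by (simp add: e_refine[OF assms(1-3)] sum_distrib_right)
  also have "\<dots> = (\<Sum>r<n m div n k. if r = p div n k then
      if p mod n k = j then e m (p div n k * n k + i) q else 0 else 0)"
  proof (intro sum.cong refl)
    fix r assume "r \<in> {..<n m div n k}"
    moreover have "r * n k + j = p \<longleftrightarrow> r = p div n k \<and> p mod n k = j"
      using assms by auto
    ultimately show "e m (r * n k + i) (r * n k + j) * e m p q = (if r = p div n k then
      if p mod n k = j then e m (p div n k * n k + i) q else 0 else 0)"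
      using assms child_less[OF assms(1), of r j] by (subst e_mult) (auto simp del: child_div_mod)
  qed
  also have "\<dots> = (if p mod n k = j then e m (p div n k * n k + i) q else 0)"
    using assms div_less_levels by simp
  finally show ?thesis .
qed

lemma e_mult_coarse:
  assumes "k \<le> m" "i < n k" "j < n k" "p < n m" "q < n m"
  shows "e m p q * e k i j = (if q mod n k = i then e m p (q div n k * n k + j) else 0)"
proof -
  have "e m p q * e k i j = star (e k j i * e m q p)"
    by (simp add: star_mult star_e)
  then show ?thesis using assms by (simp add: e_mult_fine star_e)
qed

section \<open>Elements of a finite level\<close>

definition full :: "nat \<Rightarrow> (nat \<Rightarrow> nat \<Rightarrow> complex) \<Rightarrow> 'a" where
  "full k c = (\<Sum>i<n k. \<Sum>j<n k. c i j *\<^sub>C e k i j)"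

text \<open>\<open>R\<close> is a support pattern. Equality gives the diagonal matrices of level
  \<open>k\<close>; the pattern \<open>E k p q \<subseteq> P\<close> gives the matrices supported on
  \<open>P\<close>.\<close>

definition level :: "nat \<Rightarrow> (nat \<Rightarrow> nat \<Rightarrow> bool) \<Rightarrow> 'a set" where
  "level k R = {full k c | c. \<forall>i<n k. \<forall>j<n k. c i j \<noteq> 0 \<longrightarrow> R i j}"

lemma subspace_level: "scaleC.subspace (level k R)"
proof (rule scaleC.subspaceI)
  show "0 \<in> level k R"
    unfolding level_def full_def by (intro CollectI exI[of _ "\<lambda>_ _. 0"]) simp
next
  fix x y assume "x \<in> level k R" "y \<in> level k R"
  then obtain c d where cd: "x = full k c" "\<forall>i<n k. \<forall>j<n k. c i j \<noteq> 0 \<longrightarrow> R i j"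
      "y = full k d" "\<forall>i<n k. \<forall>j<n k. d i j \<noteq> 0 \<longrightarrow> R i j"
    unfolding level_def by blast
  have "x + y = full k (\<lambda>i j. c i j + d i j)"
    unfolding cd full_def by (simp add: scaleC_add_left sum.distrib)
  moreover have "\<forall>i<n k. \<forall>j<n k. c i j + d i j \<noteq> 0 \<longrightarrow> R i j"
    using cd by (metis add_0)
  ultimately show "x + y \<in> level k R" unfolding level_def by blast
next
  fix a x assume "x \<in> level k R"
  then obtain c where c: "x = full k c" "\<forall>i<n k. \<forall>j<n k. c i j \<noteq> 0 \<longrightarrow> R i j"
    unfolding level_def by blast
  have "a *\<^sub>C x = full k (\<lambda>i j. a * c i j)"
    unfolding c full_def by (simp add: scaleC.scale_sum_right)
  moreover have "\<forall>i<n k. \<forall>j<n k. a * c i j \<noteq> 0 \<longrightarrow> R i j"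
    using c by auto
  ultimately show "a *\<^sub>C x \<in> level k R" unfolding level_def by blast
qed

lemma e_in_level:
  assumes "i < n k" "j < n k" "R i j"
  shows "e k i j \<in> level k R"
proof -
  have "full k (\<lambda>a b. if a = i \<and> b = j then 1 else 0) =
      (\<Sum>a<n k. \<Sum>b<n k. if b = j then if a = i then e k i j else 0 else 0)"
    unfolding full_def by (intro sum.cong refl) auto
  also have "\<dots> = e k i j" using assms by simp
  finally show ?thesis
    unfolding level_def using assms
    by (intro CollectI exI[of _ "\<lambda>a b. if a = i \<and> b = j then 1 else 0"]) auto
qed

lemma e_in_finer_level:
  assumes "k \<le> m" "i < n k" "j < n k"
    and "\<And>r. r < n m div n k \<Longrightarrow> R (r * n k + i) (r * n k + j)"
  shows "e k i j \<in> level m R"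
  unfolding e_refine[OF assms(1-3)]
  using assms child_less by (intro scaleC.subspace_sum subspace_level e_in_level) auto

lemma full_compress:
  assumes "p < n k" "q < n k"
  shows "e k p p * full k c * e k q q = c p q *\<^sub>C e k p q"
proof -
  have "e k p p * full k c * e k q q = (\<Sum>i<n k. \<Sum>j<n k. c i j *\<^sub>C (e k p p * e k i j * e k q q))"
    by (simp add: full_def sum_distrib_left sum_distrib_right mult_scaleC_left mult_scaleC_right mult.assoc)
  also have "\<dots> = (\<Sum>i<n k. \<Sum>j<n k. if j = q then if i = p then c p q *\<^sub>C e k p q else 0 else 0)"
    using assms by (intro sum.cong refl) (auto simp: e_mult)
  also have "\<dots> = c p q *\<^sub>C e k p q" using assms by simp
  finally show ?thesis .
qed

text \<open>A matrix of level \<open>k\<close> is also one of every finer level, so the approximant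
  can be placed beyond \<open>K\<close>. This allows a second approximant finer than the
  first.\<close>

lemma dense_levels:
  assumes "0 < \<epsilon>"
  shows "\<exists>m\<ge>K. \<exists>c. norm (a - full m c) < \<epsilon>"
proof -
  have "a \<in> closure (\<Union>k. \<phi> k ` carrier_mat (n k) (n k))"
    using uhf by (simp add: uhf_limit_def)
  then obtain k A where A: "A \<in> carrier_mat (n k) (n k)" "norm (\<phi> k A - a) < \<epsilon>"
    using assms unfolding closure_approachable by (auto simp: dist_norm)
  have "\<phi> k A \<in> level (max k K) (\<lambda>_ _. True)"
    unfolding phi_expansion[OF A(1)]
    by (intro scaleC.subspace_sum subspace_level scaleC.subspace_scale e_in_finer_level) auto
  then obtain c where "\<phi> k A = full (max k K) c"
    unfolding level_def by blast
  then show ?thesis using A(2) by (intro exI[of _ "max k K"]) (auto simp: norm_minus_commute)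
qed

section \<open>The masa\<close>

text \<open>The diagonal matrices of level \<open>m\<close> are \<open>level m (=)\<close>, and
  every element of the span of diagonal units lies in all sufficiently fine such levels. Hence the
  union in the definition of the masa is that span.\<close>

lemma masa_eq: "D = closure (scaleC.span {e k i i | k i. i < n k})"
proof -
  let ?G = "{e k i i | k i. i < n k}"
  let ?V = "\<lambda>m. \<phi> m ` {A \<in> carrier_mat (n m) (n m). diagonal_mat A}"
  have V_eq: "?V m = level m (=)" for m
  proof (intro equalityI subsetI)
    fix a assume "a \<in> ?V m"
    then obtain A where "A \<in> carrier_mat (n m) (n m)" "diagonal_mat A" "a = \<phi> m A" by blast
    then show "a \<in> level m (=)"
      unfolding level_def by (auto simp: phi_expansion full_def diagonal_mat_def intro!: exI[of _ "\<lambda>i j. A $$ (i, j)"])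
  next
    fix a assume "a \<in> level m (=)"
    then obtain c where c: "a = full m c" "\<forall>i<n m. \<forall>j<n m. c i j \<noteq> 0 \<longrightarrow> i = j"
      unfolding level_def by blast
    let ?A = "mat (n m) (n m) (\<lambda>(i, j). c i j)"
    have "?A \<in> carrier_mat (n m) (n m)" "diagonal_mat ?A"
      using c by (auto simp: diagonal_mat_def)
    moreover have "\<phi> m ?A = a"
      unfolding c full_def by (subst phi_expansion) (auto intro!: sum.cong)
    ultimately show "a \<in> ?V m" by blast
  qed
  have "level m (=) \<subseteq> scaleC.span ?G" for m
  proof
    fix a assume "a \<in> level m (=)"
    then obtain c where c: "a = full m c" "\<forall>i<n m. \<forall>j<n m. c i j \<noteq> 0 \<longrightarrow> i = j"
      unfolding level_def by blast
    have "c i j *\<^sub>C e m i j \<in> scaleC.span ?G" if "i < n m" "j < n m" for i j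
    proof (cases "i = j")
      case False
      then show ?thesis using c that scaleC.span_zero by force
    next
      case True
      then have "e m i j \<in> ?G" using that by auto
      then show ?thesis by (intro scaleC.span_scale scaleC.span_base)
    qed
    then show "a \<in> scaleC.span ?G"
      unfolding c full_def by (intro scaleC.span_sum) auto
  qed
  then have le: "(\<Union>m. level m (=)) \<subseteq> scaleC.span ?G"
    by (rule UN_least)
  have "?G \<subseteq> {a. \<exists>k. \<forall>m\<ge>k. a \<in> level m (=)}"
  proof
    fix a assume "a \<in> ?G"
    then obtain k i where a: "a = e k i i" "i < n k" by blast
    have "a \<in> level m (=)" if "k \<le> m" for m
      unfolding a(1) by (rule e_in_finer_level) (use that a in auto)
    then show "a \<in> {a. \<exists>k. \<forall>m\<ge>k. a \<in> level m (=)}"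
      by blast
  qed
  then have "scaleC.span ?G \<subseteq> {a. \<exists>k. \<forall>m\<ge>k. a \<in> level m (=)}"
    by (rule scaleC.span_minimal) (rule subspace_eventually[OF subspace_level])
  also have "\<dots> \<subseteq> (\<Union>m. level m (=))"
  proof
    fix a assume "a \<in> {a. \<exists>k. \<forall>m\<ge>k. a \<in> level m (=)}"
    then obtain k where "a \<in> level k (=)" by auto
    then show "a \<in> (\<Union>m. level m (=))" by (rule UN_I[OF UNIV_I])
  qed
  finally have "(\<Union>m. level m (=)) = scaleC.span ?G"
    using le by (intro equalityI)
  then have "(\<Union>m. ?V m) = scaleC.span ?G"
    by (simp only: V_eq)
  then show ?thesis by (simp add: uhf_masa_def)
qed

lemma masa_subspace: "scaleC.subspace D"
  unfolding masa_eq by (intro subspace_closure scaleC.subspace_span)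

lemma masa_closed: "closed D"
  unfolding masa_eq by simp

text \<open>The induction principle for the masa: a property defining a closed subspace needs
  checking on diagonal units only.\<close>

lemma masa_subsetI:
  assumes "scaleC.subspace V" "closed V" "\<And>k i. i < n k \<Longrightarrow> e k i i \<in> V"
  shows "D \<subseteq> V"
  unfolding masa_eq using assms by (intro closure_span_minimal) auto

lemma e_in_masa: "i < n k \<Longrightarrow> e k i i \<in> D"
  unfolding masa_eq by (intro set_mp[OF closure_subset] scaleC.span_base) auto

lemma one_in_masa: "1 \<in> D"
  using scaleC.subspace_sum[OF masa_subspace, of "{..<n 0}" "\<lambda>i. e 0 i i"] sum_e[of 0] e_in_masa
  by simp

lemma e_diag_mult:
  assumes "k \<le> m" "i < n k" "p < n m"
  shows "e k i i * e m p p = (if p mod n k = i then e m p p else 0)"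
    and "e m p p * e k i i = (if p mod n k = i then e m p p else 0)"
  using assms e_mult_fine[of k m i i p p] e_mult_coarse[of k m i i p p]
  by (auto simp: div_mult_mod_eq)

text \<open>Induction on the masa twice: first in \<open>d\<close> with a diagonal unit as second
  factor, then in \<open>f\<close>. Two diagonal units multiply to the finer one or to 0.\<close>

lemma masa_mult:
  assumes "d \<in> D" "f \<in> D"
  shows "d * f \<in> D"
proof -
  have gen: "d * e m p p \<in> D" if d: "d \<in> D" and "p < n m" for d m p
  proof -
    have "e k i i * e m p p \<in> D" if "i < n k" for k i
      using e_diag_mult(1)[of k m i p] e_diag_mult(2)[of m k p i] that \<open>p < n m\<close>
      by (cases "k \<le> m") (auto simp: e_in_masa scaleC.subspace_0[OF masa_subspace])
    \<comment> \<open>The factor 1 fits the two-sided form of the preimage lemmas.\<close>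
    then have "D \<subseteq> {d. 1 * d * e m p p \<in> D}"
      by (intro masa_subsetI mult_preimage_subspace mult_preimage_closed masa_subspace masa_closed) auto
    then show ?thesis using d by auto
  qed
  have "D \<subseteq> {f. d * f * 1 \<in> D}"
    using gen assms
    by (intro masa_subsetI mult_preimage_subspace mult_preimage_closed masa_subspace masa_closed) auto
  then show ?thesis using assms by auto
qed

lemma subspace_commutant: "scaleC.subspace {d::'a. d * f = f * d}"
  unfolding scaleC.subspace_def
  by (auto simp: distrib_left distrib_right mult_scaleC_left mult_scaleC_right)

lemma closed_commutant: "closed {d::'a. d * f = f * d}"
  by (intro closed_Collect_eq continuous_intros)

lemma masa_commute:
  assumes "d \<in> D" "f \<in> D"
  shows "d * f = f * d"
proof -
  have gen: "d * e m p p = e m p p * d" if d: "d \<in> D" and "p < n m" for d m p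
  proof -
    have "e k i i * e m p p = e m p p * e k i i" if "i < n k" for k i
      using e_diag_mult[of k m i p] e_diag_mult[of m k p i] that \<open>p < n m\<close>
      by (cases "k \<le> m") auto
    then have "D \<subseteq> {d. d * e m p p = e m p p * d}"
      by (intro masa_subsetI subspace_commutant closed_commutant) auto
    then show ?thesis using d by auto
  qed
  have "D \<subseteq> {f. f * d = d * f}"
    using gen assms by (intro masa_subsetI subspace_commutant closed_commutant) auto
  then show ?thesis using assms by auto
qed

text \<open>Matrix units normalize the masa. A finer diagonal unit below \<open>e k i i\<close> is
  moved to the corresponding child of \<open>j\<close>; a coarser one acts on \<open>e k j i\<close>
  as 0 or as the identity.\<close>

lemma masa_conj:
  assumes "d \<in> D" "i < n k" "j < n k"
  shows "e k j i * d * e k i j \<in> D"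
proof -
  have "e k j i * e m p p * e k i j \<in> D" if p: "p < n m" for m p
  proof (cases "k \<le> m")
    case True
    have "p div n k * n k + j < n m"
      using child_less[OF True div_less_levels[OF True p]] assms by simp
    then show ?thesis
      using True p assms
      by (auto simp: e_mult_fine e_mult_coarse e_in_masa scaleC.subspace_0[OF masa_subspace])
  next
    case False
    then have "e k j i * e m p p = (if i mod n m = p then e k j i else 0)"
      using p assms e_mult_coarse[of m k p p j i] by auto
    then show ?thesis
      using assms by (auto simp: e_mult e_in_masa scaleC.subspace_0[OF masa_subspace])
  qed
  then have "D \<subseteq> {d. e k j i * d * e k i j \<in> D}"
    by (intro masa_subsetI mult_preimage_subspace mult_preimage_closed masa_subspace masa_closed) auto
  then show ?thesis using assms by auto
qed

section \<open>Characters and the relation\<close>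

abbreviation X :: "('a \<Rightarrow> complex) set" where "X \<equiv> uhf_spectrum n \<phi>"
abbreviation cyl :: "nat \<Rightarrow> nat \<Rightarrow> ('a \<Rightarrow> complex) set" where "cyl \<equiv> uhf_cylinder n \<phi>"
abbreviation shift where "shift \<equiv> uhf_shift n \<phi>"
abbreviation E where "E \<equiv> uhf_graph n \<phi>"

section \<open>Characters and cylinders\<close>

lemma spectrum_add: "y \<in> X \<Longrightarrow> d \<in> D \<Longrightarrow> f \<in> D \<Longrightarrow> y (d + f) = y d + y f"
  by (simp add: uhf_spectrum_def)

lemma spectrum_mult: "y \<in> X \<Longrightarrow> d \<in> D \<Longrightarrow> f \<in> D \<Longrightarrow> y (d * f) = y d * y f"
  by (simp add: uhf_spectrum_def)

lemma spectrum_scale: "y \<in> X \<Longrightarrow> d \<in> D \<Longrightarrow> y (c *\<^sub>C d) = c * y d"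
  by (simp add: uhf_spectrum_def)

lemma spectrum_extensional: "y \<in> X \<Longrightarrow> y \<in> extensional D"
  by (simp add: uhf_spectrum_def)

lemma spectrum_0: "y \<in> X \<Longrightarrow> y 0 = 0"
  using spectrum_add[of y 0 0] scaleC.subspace_0[OF masa_subspace] by simp

lemma spectrum_1:
  assumes "y \<in> X"
  shows "y 1 = 1"
proof -
  obtain d where "d \<in> D" "y d \<noteq> 0" using assms unfolding uhf_spectrum_def by blast
  then show ?thesis using spectrum_mult[OF assms, of d 1] one_in_masa by simp
qed

lemma spectrum_sum:
  assumes "y \<in> X" "\<And>i. i \<in> I \<Longrightarrow> f i \<in> D"
  shows "y (\<Sum>i\<in>I. f i) = (\<Sum>i\<in>I. y (f i))"
  using assms(2)
proof (induction I rule: infinite_finite_induct)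
  case (insert i I)
  then show ?case
    using scaleC.subspace_sum[OF masa_subspace, of I f] by (simp add: spectrum_add assms(1))
qed (simp_all add: spectrum_0 assms(1))

lemma cylinder_in_spectrum: "y \<in> cyl k i \<Longrightarrow> y \<in> X"
  by (simp add: uhf_cylinder_def)

lemma cylinder_value: "y \<in> cyl k i \<Longrightarrow> y (e k i i) = 1"
  by (simp add: uhf_cylinder_def)

text \<open>The diagonal units of one level are idempotents with sum 1, so a character takes the
  values 0 or 1 on them and cannot vanish on all.\<close>

lemma cylinder_exists:
  assumes "y \<in> X"
  obtains i where "i < n k" "y \<in> cyl k i"
proof -
  have "\<exists>i<n k. y (e k i i) = 1"
  proof (rule ccontr)
    assume no: "\<not> ?thesis"
    have "y (e k i i) = 0" if "i < n k" for i
    proof -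
      have "y (e k i i) * y (e k i i) = y (e k i i)"
        using spectrum_mult[OF assms, of "e k i i" "e k i i"] that e_in_masa by (simp add: e_mult)
      then show ?thesis using no that by auto
    qed
    then have "y 1 = 0"
      using spectrum_sum[OF assms, of "{..<n k}" "\<lambda>i. e k i i"] e_in_masa by (simp add: sum_e)
    then show False using spectrum_1[OF assms] by simp
  qed
  then show thesis using that assms by (auto simp: uhf_cylinder_def)
qed

lemma cylinder_unique:
  assumes "y \<in> cyl k i" "y \<in> cyl k j" "i < n k" "j < n k"
  shows "i = j"
proof (rule ccontr)
  assume "i \<noteq> j"
  then have "y 0 = y (e k i i) * y (e k j j)"
    using spectrum_mult[OF cylinder_in_spectrum[OF assms(1)], of "e k i i" "e k j j"] assms e_in_masa
    by (simp add: e_mult)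
  then show False
    using assms spectrum_0[OF cylinder_in_spectrum[OF assms(1)]] by (simp add: cylinder_value)
qed

text \<open>\<open>e m q q\<close> lies below \<open>e k (q mod n k) (q mod n k)\<close>.\<close>

lemma cylinder_coarsen:
  assumes "k \<le> m" "q < n m" "y \<in> cyl m q"
  shows "y \<in> cyl k (q mod n k)"
proof -
  have y: "y \<in> X" using assms cylinder_in_spectrum by blast
  have "y (e k (q mod n k) (q mod n k)) * y (e m q q) = y (e m q q)"
    using spectrum_mult[OF y, of "e k (q mod n k) (q mod n k)" "e m q q"] e_in_masa assms
      e_diag_mult(1)[of k m "q mod n k" q] mod_less_level by simp
  then show ?thesis using y by (simp add: uhf_cylinder_def cylinder_value[OF assms(3)])
qed

lemma cylinder_corner:
  assumes "y \<in> cyl k i" "i < n k" "d \<in> D"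
  shows "y (e k i i * d * e k i i) = y d"
  using assms spectrum_mult[OF cylinder_in_spectrum[OF assms(1)]] e_in_masa masa_mult
  by (simp add: cylinder_value)

section \<open>The partial homeomorphisms of the spectrum\<close>

lemma shift_apply: "d \<in> D \<Longrightarrow> shift k i j y d = y (e k j i * d * e k i j)"
  by (simp add: uhf_shift_def)

lemma e_mult_masa_middle:
  assumes "d \<in> D" "i < n k" "j < n k"
  shows "e k j i * d * e k i i = e k j i * d"
proof -
  have "e k j i * d * e k i i = e k j i * (e k i i * d)"
    using masa_commute[OF assms(1) e_in_masa[OF assms(2)]] by (simp add: mult.assoc)
  also have "\<dots> = e k j i * d"
    using assms by (simp add: e_mult flip: mult.assoc)
  finally show ?thesis .
qed

lemma shift_in_cylinder:
  assumes y: "y \<in> cyl k j" and ij: "i < n k" "j < n k"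
  shows "shift k i j y \<in> cyl k i"
proof -
  have yX: "y \<in> X" using y cylinder_in_spectrum by blast
  have conj: "e k j i * d * e k i j \<in> D" if "d \<in> D" for d
    using masa_conj that ij by blast
  have one: "shift k i j y (e k i i) = 1"
    using ij y by (simp add: shift_apply e_in_masa e_mult cylinder_value)
  have "shift k i j y (d + f) = shift k i j y d + shift k i j y f" if "d \<in> D" "f \<in> D" for d f
    using that conj spectrum_add[OF yX] scaleC.subspace_add[OF masa_subspace]
    by (simp add: shift_apply distrib_left distrib_right)
  moreover have "shift k i j y (d * f) = shift k i j y d * shift k i j y f" if "d \<in> D" "f \<in> D" for d f
  proof -
    \<comment> \<open>The middle product is \<open>e k i i\<close>, which commutes with
      \<open>d\<close> and is absorbed by \<open>e k j i\<close>; this is multiplicativity of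
      conjugation.\<close>
    have "(e k j i * d * e k i j) * (e k j i * f * e k i j) = e k j i * d * (e k i j * e k j i) * f * e k i j"
      by (simp add: mult.assoc)
    also have "\<dots> = e k j i * (d * f) * e k i j"
      using ij that by (simp add: e_mult e_mult_masa_middle) (simp add: mult.assoc)
    finally show ?thesis
      using that conj spectrum_mult[OF yX] masa_mult by (metis shift_apply)
  qed
  moreover have "shift k i j y (c *\<^sub>C d) = c * shift k i j y d" if "d \<in> D" for c d
    using that conj spectrum_scale[OF yX] scaleC.subspace_scale[OF masa_subspace]
    by (simp add: shift_apply mult_scaleC_left mult_scaleC_right)
  moreover have "shift k i j y \<in> extensional D"
    by (simp add: uhf_shift_def)
  moreover have "\<exists>d\<in>D. shift k i j y d \<noteq> 0"
    using one e_in_masa ij by (intro bexI[of _ "e k i i"]) auto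
  ultimately have "shift k i j y \<in> X"
    unfolding uhf_spectrum_def by blast
  then show ?thesis using one by (simp add: uhf_cylinder_def)
qed

lemma shift_diag:
  assumes "y \<in> cyl k i" "i < n k"
  shows "shift k i i y = y"
  using assms spectrum_extensional[OF cylinder_in_spectrum[OF assms(1)]]
  by (intro extensionalityI[of _ D]) (auto simp: uhf_shift_def cylinder_corner)

lemma shift_shift:
  assumes y: "y \<in> cyl k j" and ij: "i < n k" "j < n k"
  shows "shift k j i (shift k i j y) = y"
proof (rule extensionalityI[of _ D])
  show "y \<in> extensional D"
    using y cylinder_in_spectrum spectrum_extensional by blast
  fix d assume d: "d \<in> D"
  have "shift k j i (shift k i j y) d = y ((e k j i * e k i j) * d * (e k j i * e k i j))"
    using d masa_conj[OF d ij(2,1)] by (simp add: shift_apply mult.assoc)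
  also have "\<dots> = y d" using ij d y by (simp add: e_mult cylinder_corner)
  finally show "shift k j i (shift k i j y) d = y d" .
qed (simp add: uhf_shift_def)

text \<open>A character in the cylinder of \<open>e m ?q ?q\<close> sees only the corner of that
  projection, and there \<open>e k i j\<close> becomes its child \<open>e m ?p ?q\<close>.\<close>

lemma shift_refine:
  assumes "k \<le> m" "r < n m div n k" and ij: "i < n k" "j < n k" and y: "y \<in> cyl m (r * n k + j)"
  shows "shift k i j y = shift m (r * n k + i) (r * n k + j) y"
proof (rule extensionalityI[of _ D])
  let ?p = "r * n k + i" and ?q = "r * n k + j"
  have pq: "?p < n m" "?q < n m" using assms child_less by auto
  fix d assume d: "d \<in> D"
  have "shift k i j y d = y (e m ?q ?q * (e k j i * d * e k i j) * e m ?q ?q)"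
    using cylinder_corner[OF y pq(2) masa_conj[OF d ij]] d by (simp add: shift_apply)
  also have "\<dots> = y ((e m ?q ?q * e k j i) * d * (e k i j * e m ?q ?q))"
    by (simp add: mult.assoc)
  also have "\<dots> = shift m ?p ?q y d"
    using assms pq d by (simp add: e_mult_coarse e_mult_fine shift_apply)
  finally show "shift k i j y d = shift m ?p ?q y d" .
qed (auto simp: uhf_shift_def)

section \<open>The graphs and the topology of the relation\<close>

lemma graphE:
  assumes "(x, y) \<in> E k i j" "i < n k" "j < n k"
  shows "x = shift k i j y" "y \<in> cyl k j" "x \<in> cyl k i"
  using assms shift_in_cylinder by (auto simp: uhf_graph_def)

lemma graph_converse:
  assumes "i < n k" "j < n k" "(x, y) \<in> E k i j"
  shows "(y, x) \<in> E k j i"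
proof -
  note xy = graphE[OF assms(3,1,2)]
  then have "y = shift k j i x" using shift_shift[OF xy(2) assms(1,2)] by simp
  then show ?thesis using xy(3) by (auto simp: uhf_graph_def)
qed

text \<open>The counterpart of \<open>e_refine\<close>: every \<open>y\<close> in a cylinder of
  level \<open>k\<close> lies in some cylinder of level \<open>m\<close>, whose index must descend
  from \<open>j\<close>, and \<open>shift_refine\<close> identifies the shifts there.\<close>

lemma graph_refine:
  assumes "k \<le> m" "i < n k" "j < n k"
  shows "E k i j = (\<Union>r<n m div n k. E m (r * n k + i) (r * n k + j))"
proof (intro equalityI subsetI)
  fix z assume "z \<in> E k i j"
  then obtain y where z: "z = (shift k i j y, y)" "y \<in> cyl k j" by (auto simp: uhf_graph_def)
  obtain q where q: "q < n m" "y \<in> cyl m q"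
    using cylinder_exists cylinder_in_spectrum[OF z(2)] by blast
  have "q mod n k = j"
    using cylinder_unique[OF cylinder_coarsen[OF assms(1) q] z(2)] assms mod_less_level by simp
  then have q': "q = (q div n k) * n k + j" by (metis div_mult_mod_eq)
  moreover have "q div n k < n m div n k" using q assms div_less_levels by simp
  moreover have "z \<in> E m (q div n k * n k + i) (q div n k * n k + j)"
    using z q q' shift_refine[of k m "q div n k" i j y] assms calculation
    by (auto simp: uhf_graph_def simp del: div_mult_mod_eq)
  ultimately show "z \<in> (\<Union>r<n m div n k. E m (r * n k + i) (r * n k + j))" by blast
next
  fix z assume "z \<in> (\<Union>r<n m div n k. E m (r * n k + i) (r * n k + j))"
  then obtain r y where z: "r < n m div n k" "z = (shift m (r * n k + i) (r * n k + j) y, y)"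
      "y \<in> cyl m (r * n k + j)"
    by (auto simp: uhf_graph_def)
  have "y \<in> cyl k j"
    using cylinder_coarsen[OF assms(1) _ z(3)] child_less[OF assms(1) z(1) assms(3)] assms by simp
  then show "z \<in> E k i j"
    using z shift_refine[OF assms(1) z(1) assms(2,3) z(3)] by (auto simp: uhf_graph_def)
qed

text \<open>The common point lies in a child of \<open>E k i j\<close> at level \<open>m\<close>,
  and graphs of one level are disjoint because the cylinders of a point's coordinates determine row
  and column.\<close>

lemma graph_overlap:
  assumes "k \<le> m" and ij: "i < n k" "j < n k" and pq: "p < n m" "q < n m"
    and z: "z \<in> E k i j" "z \<in> E m p q"
  obtains r where "r < n m div n k" "p = r * n k + i" "q = r * n k + j"
proof -
  obtain x y where xy: "z = (x, y)" by force
  obtain r where r: "r < n m div n k" "z \<in> E m (r * n k + i) (r * n k + j)"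
    using z(1) graph_refine[OF assms(1) ij] by blast
  have "r * n k + i < n m" "r * n k + j < n m" using r assms child_less by auto
  then have "p = r * n k + i" "q = r * n k + j"
    using graphE[of x y m "r * n k + i" "r * n k + j"] graphE[of x y m p q] r z pq
      cylinder_unique xy by blast+
  then show thesis using that r by blast
qed

lemma e_child:
  assumes "k \<le> m" "i < n k" "j < n k" "r < n m div n k"
  shows "e m (r * n k + i) (r * n k + i) * e k i j * e m (r * n k + j) (r * n k + j) =
    e m (r * n k + i) (r * n k + j)"
  using assms child_less by (simp add: e_mult_coarse e_mult)

text \<open>Induction over the generated topology. Only intersections need an argument: two graphs
  through a common point are nested by \<open>graph_overlap\<close>, so the finer one
  serves.\<close>

lemma open_relation_base:
  assumes "openin (uhf_relation n \<phi>) P" "z \<in> P"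
  shows "\<exists>k i j. i < n k \<and> j < n k \<and> z \<in> E k i j \<and> E k i j \<subseteq> P"
proof -
  have "generate_topology_on {E k i j | k i j. i < n k \<and> j < n k} P"
    using assms by (simp add: uhf_relation_def openin_topology_generated_by_iff)
  then show ?thesis using assms(2)
  proof (induction arbitrary: z)
    case (Int a b)
    have "z \<in> a" "z \<in> b" using Int.prems by simp_all
    obtain k i j where a: "i < n k" "j < n k" "z \<in> E k i j" "E k i j \<subseteq> a"
      using Int.IH(1)[OF \<open>z \<in> a\<close>] by (elim exE conjE)
    obtain m p q where b: "p < n m" "q < n m" "z \<in> E m p q" "E m p q \<subseteq> b"
      using Int.IH(2)[OF \<open>z \<in> b\<close>] by (elim exE conjE)
    have nested: "E m' p' q' \<subseteq> E k' i' j'"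
      if h: "k' \<le> m'" "i' < n k'" "j' < n k'" "p' < n m'" "q' < n m'" "z \<in> E k' i' j'" "z \<in> E m' p' q'"
      for k' m' i' j' p' q'
    proof -
      obtain r where "r < n m' div n k'" "p' = r * n k' + i'" "q' = r * n k' + j'"
        by (rule graph_overlap[OF h])
      then show ?thesis using graph_refine[OF h(1-3)] by blast
    qed
    show ?case
    proof (cases "k \<le> m")
      case True
      then have "E m p q \<subseteq> E k i j" using nested a b by blast
      then show ?thesis using a b by blast
    next
      case False
      then have "E k i j \<subseteq> E m p q" using nested[of m k] a b by simp
      then show ?thesis using a b by blast
    qed
  next
    case (UN K)
    then obtain b where b: "b \<in> K" "z \<in> b" by (elim UnionE)
    obtain k i j where "i < n k" "j < n k" "z \<in> E k i j" "E k i j \<subseteq> b"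
      using UN.IH[OF b] by (elim exE conjE)
    then show ?case using b(1) Union_upper[of b K] by blast
  qed blast+
qed

lemma openin_graph: "i < n k \<Longrightarrow> j < n k \<Longrightarrow> openin (uhf_relation n \<phi>) (E k i j)"
  unfolding uhf_relation_def by (intro topology_generated_by_Basis) blast

text \<open>The character picks the approximate eigenvalue of \<open>d\<close> on the decreasing projections \<open>f t\<close> of the branch.\<close>

lemma branch_character:
  assumes less: "\<And>m. k \<le> m \<Longrightarrow> q m < n m"
    and branch: "\<And>m. k \<le> m \<Longrightarrow> q (Suc m) mod n m = q m"
  obtains y where "\<And>m. k \<le> m \<Longrightarrow> y \<in> cyl m (q m)"
proof -
  define f where "f t = e (k + t) (q (k + t)) (q (k + t))" for t
  have f: "norm (f t) = 1" for t
    unfolding f_def using less[of "k + t"] by (simp add: norm_e)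
  \<comment> \<open>From level \<open>M\<close> on, the ancestor of the branch at any level
    \<open>l \<le> M\<close> no longer changes.\<close>
  have coarse: "q m mod n l = q M mod n l" if "k \<le> M" "l \<le> M" "M \<le> m" for l M m
    using that(3)
  proof (induction rule: dec_induct)
    case (step m)
    have "q (Suc m) mod n l = q (Suc m) mod n m mod n l"
      using n_dvd[of l m] that step by (simp add: mod_mod_cancel)
    then show ?case using step branch[of m] that by simp
  qed simp
  \<comment> \<open>On diagonal units the eigenvalue equation holds exactly for large
    \<open>t\<close>, with eigenvalue 1 or 0 according to whether the branch passes through
    \<open>i\<close> at level \<open>l\<close>.\<close>
  have gen: "(\<lambda>t. f t * e l i i - (if q M mod n l = i then 1 else 0) *\<^sub>C f t) \<longlonglongrightarrow> 0"
    if "k \<le> M" "l \<le> M" "i < n l" for l i M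
  proof (rule tendsto_eventually, rule eventually_sequentiallyI)
    fix t assume "M \<le> t"
    then have "M \<le> k + t" by simp
    then show "f t * e l i i - (if q M mod n l = i then 1 else 0) *\<^sub>C f t = 0"
      using that less[of "k + t"] coarse[OF that(1,2), of "k + t"] e_diag_mult(2)[of l "k + t" i "q (k + t)"]
      by (auto simp: f_def)
  qed
  have "D \<subseteq> {d. \<exists>c. (\<lambda>t. f t * d - c *\<^sub>C f t) \<longlonglongrightarrow> 0}"
  proof (rule masa_subsetI[OF approx_eigen_subspace approx_eigen_closed[OF f]])
    show "e l i i \<in> {d. \<exists>c. (\<lambda>t. f t * d - c *\<^sub>C f t) \<longlonglongrightarrow> 0}" if "i < n l" for l i
      using gen[of "max k l" l i] that by auto
  qed
  then have "\<forall>d\<in>D. \<exists>c. (\<lambda>t. f t * d - c *\<^sub>C f t) \<longlonglongrightarrow> 0" by blast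
  from bchoice[OF this] obtain x where x: "\<And>d. d \<in> D \<Longrightarrow> (\<lambda>t. f t * d - x d *\<^sub>C f t) \<longlonglongrightarrow> 0"
    by blast
  have eq: "x d = c" if "d \<in> D" "(\<lambda>t. f t * d - c *\<^sub>C f t) \<longlonglongrightarrow> 0" for d c
    using approx_eigen_unique[OF f x[OF that(1)] that(2)] .
  define y where "y = restrict x D"
  have one: "y (e m (q m) (q m)) = 1" if "k \<le> m" for m
    unfolding y_def using gen[of m m "q m"] that less[OF that] e_in_masa
    by (simp add: eq)
  have "y \<in> X"
    unfolding uhf_spectrum_def
  proof (intro CollectI conjI ballI allI)
    show "y \<in> extensional D" by (simp add: y_def)
  next
    fix d g assume dg: "d \<in> D" "g \<in> D"
    show "y (d + g) = y d + y g"
      using dg scaleC.subspace_add[OF masa_subspace dg] eq[OF _ approx_eigen_add[OF x x]]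
      by (simp add: y_def)
    show "y (d * g) = y d * y g"
      using dg masa_mult[OF dg] eq[OF _ approx_eigen_mult[OF x x]]
      by (simp add: y_def)
  next
    fix d c assume d: "d \<in> D"
    show "y (c *\<^sub>C d) = c * y d"
      using d scaleC.subspace_scale[OF masa_subspace d] eq[OF _ approx_eigen_scale[OF x]]
      by (simp add: y_def)
  next
    show "\<exists>d\<in>D. y d \<noteq> 0"
      using one[of k] less[of k] e_in_masa by (intro bexI[of _ "e k (q k) (q k)"]) auto
  qed
  then show thesis
    using one by (intro that[of y]) (simp add: uhf_cylinder_def)
qed

section \<open>Bimodules\<close>

definition bimodule :: "'a set \<Rightarrow> bool" where
  "bimodule S \<longleftrightarrow> scaleC.subspace S \<and> (\<forall>d\<in>D. \<forall>s\<in>S. \<forall>f\<in>D. d * s * f \<in> S)"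

lemma bimodule_compress: "bimodule S \<Longrightarrow> s \<in> S \<Longrightarrow> p < n m \<Longrightarrow> q < n m \<Longrightarrow> e m p p * s * e m q q \<in> S"
  using e_in_masa by (simp add: bimodule_def)

lemma bimodule_child:
  assumes "bimodule S" "e k i j \<in> S" "k \<le> m" "i < n k" "j < n k" "r < n m div n k"
  shows "e m (r * n k + i) (r * n k + j) \<in> S"
  using bimodule_compress[OF assms(1,2), of "r * n k + i" m "r * n k + j"] assms child_less
  by (simp add: e_child)

lemma graph_not_covered:
  assumes S: "bimodule S" and ij: "i < n k" "j < n k" and notin: "e k i j \<notin> S"
  obtains z where "z \<in> E k i j"
    and "\<And>m p q. p < n m \<Longrightarrow> q < n m \<Longrightarrow> e m p q \<in> S \<Longrightarrow> z \<notin> E m p q"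
proof -
  let ?P = "\<lambda>t r. r < n (k + t) div n k \<and> e (k + t) (r * n k + i) (r * n k + j) \<notin> S"
  \<comment> \<open>Successive choices have to be compatible, so that the column indices form a
    branch.\<close>
  let ?Q = "\<lambda>t r r'. (r' * n k + j) mod n (k + t) = r * n k + j"
  have "\<exists>r. \<forall>t. ?P t (r t) \<and> ?Q t (r t) (r (Suc t))"
  proof (rule dependent_nat_choice[where P = ?P and Q = ?Q])
    show "\<exists>r. ?P 0 r"
      using notin n_pos[of k] by (intro exI[of _ 0]) simp
  next
    fix r t assume r: "?P t r"
    let ?m = "k + t"
    have p: "r * n k + i < n ?m" and q: "r * n k + j < n ?m"
      using r ij child_less[of k ?m] by auto
    \<comment> \<open>If all children were in the subspace \<open>S\<close>, so would be their sum,
      the parent.\<close>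
    have "\<exists>u<n (Suc ?m) div n ?m. e (Suc ?m) (u * n ?m + (r * n k + i)) (u * n ?m + (r * n k + j)) \<notin> S"
    proof (rule ccontr)
      assume "\<not> ?thesis"
      then have "(\<Sum>u<n (Suc ?m) div n ?m. e (Suc ?m) (u * n ?m + (r * n k + i)) (u * n ?m + (r * n k + j))) \<in> S"
        using S by (intro scaleC.subspace_sum) (auto simp: bimodule_def)
      then show False using r e_refine[of ?m "Suc ?m", OF _ p q] by simp
    qed
    then obtain u where u: "u < n (Suc ?m) div n ?m"
        "e (Suc ?m) (u * n ?m + (r * n k + i)) (u * n ?m + (r * n k + j)) \<notin> S"
      by blast
    \<comment> \<open>The number, relative to level \<open>k\<close>, of child \<open>u\<close> of
      child \<open>r\<close>.\<close>
    define r' where "r' = u * (n ?m div n k) + r"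
    have r': "r' * n k + a = u * n ?m + (r * n k + a)" for a
      using n_mult_div[of k ?m] by (simp add: r'_def distrib_right mult.assoc)
    have "r' * n k + j < n (Suc ?m)"
      unfolding r' using u(1) q by (intro child_less[of "k + t" "Suc (k + t)"]) simp_all
    then have "r' < n (Suc ?m) div n k"
      using div_less_levels[of k "Suc ?m" "r' * n k + j"] ij by simp
    moreover have "?Q t r r'"
      unfolding r' using q by simp
    ultimately show "\<exists>r'. ?P (Suc t) r' \<and> ?Q t r r'"
      using u(2) by (intro exI[of _ r']) (simp add: r')
  qed
  then obtain r where r: "\<And>t. ?P t (r t)" "\<And>t. ?Q t (r t) (r (Suc t))" by blast
  \<comment> \<open>The branch follows columns because the second coordinate of a point of
    \<open>E k i j\<close> is the character and the first its shift.\<close>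
  define b where "b m = r (m - k) * n k + j" for m
  have P: "r (m - k) < n m div n k" "e m (r (m - k) * n k + i) (r (m - k) * n k + j) \<notin> S"
    if "k \<le> m" for m
    using r(1)[of "m - k"] that by auto
  have "b m < n m" if "k \<le> m" for m
    unfolding b_def using P(1)[OF that] that ij by (intro child_less)
  moreover have "b (Suc m) mod n m = b m" if "k \<le> m" for m
    using r(2)[of "m - k"] that by (simp add: b_def Suc_diff_le)
  ultimately obtain y where y: "\<And>m. k \<le> m \<Longrightarrow> y \<in> cyl m (b m)"
    using branch_character[of k b] by blast
  have bk: "b k = j" using P(1)[of k] n_pos[of k] by (simp add: b_def)
  let ?z = "(shift k i j y, y)"
  show thesis
  proof (rule that[of ?z])
    show "?z \<in> E k i j"
      using y[of k] bk by (auto simp: uhf_graph_def)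
    fix m p q assume pq: "p < n m" "q < n m" "e m p q \<in> S"
    show "?z \<notin> E m p q"
    proof
      assume z: "?z \<in> E m p q"
      \<comment> \<open>At a common level, the unit on the chosen branch would descend from
        \<open>e m p q\<close> and hence belong to \<open>S\<close>.\<close>
      define M where "M = max k m"
      have M: "k \<le> M" "m \<le> M" by (simp_all add: M_def)
      let ?p = "r (M - k) * n k + i" and ?q = "r (M - k) * n k + j"
      have yM: "y \<in> cyl M ?q" using y[OF M(1)] by (simp add: b_def)
      have zM: "?z \<in> E M ?p ?q"
        using shift_refine[OF M(1) P(1)[OF M(1)] ij yM] yM by (auto simp: uhf_graph_def)
      have less: "?p < n M" "?q < n M"
        using child_less[OF M(1) P(1)[OF M(1)]] ij by auto
      obtain u where u: "u < n M div n m" "?p = u * n m + p" "?q = u * n m + q"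
        using graph_overlap[OF M(2) pq(1,2) less z zM] by blast
      then have "e M ?p ?q \<in> S"
        using bimodule_child[OF S pq(3) M(2) pq(1,2) u(1)] by simp
      then show False using P(2)[OF M(1)] by simp
    qed
  qed
qed

section \<open>Pinching\<close>

text \<open>The projection onto the \<open>r\<close>-th diagonal block of size \<open>n k\<close> in
  level \<open>m\<close>. These are the minimal projections of the part of the diagonal of level
  \<open>m\<close> that commutes with level \<open>k\<close>.\<close>

definition cut :: "nat \<Rightarrow> nat \<Rightarrow> nat \<Rightarrow> 'a" where
  "cut k m r = (\<Sum>i<n k. e m (r * n k + i) (r * n k + i))"

definition pinch :: "nat \<Rightarrow> nat \<Rightarrow> 'a \<Rightarrow> 'a" where
  "pinch k m a = (\<Sum>r<n m div n k. cut k m r * a * cut k m r)"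

definition pinch_block :: "nat \<Rightarrow> nat \<Rightarrow> nat \<Rightarrow> nat \<Rightarrow> 'a \<Rightarrow> 'a" where
  "pinch_block k m i j a =
     (\<Sum>r<n m div n k. e m (r * n k + i) (r * n k + i) * a * e m (r * n k + j) (r * n k + j))"

lemma e_mult_cut:
  assumes "k \<le> m" "i < n k" "j < n k" "r < n m div n k"
  shows "e k i j * cut k m r = e m (r * n k + i) (r * n k + j)"
proof -
  have "e k i j * cut k m r = (\<Sum>b<n k. if b = j then e m (r * n k + i) (r * n k + b) else 0)"
    unfolding cut_def sum_distrib_left using assms
    by (intro sum.cong refl) (simp add: e_mult_fine child_less)
  then show ?thesis using assms by simp
qed

lemma star_cut: "star (cut k m r) = cut k m r"
  by (simp add: cut_def star_sum star_e)

lemma cut_mult_e: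
  assumes "k \<le> m" "i < n k" "j < n k" "r < n m div n k"
  shows "cut k m r * e k i j = e m (r * n k + i) (r * n k + j)"
proof -
  have "cut k m r * e k i j = star (e k j i * cut k m r)"
    by (simp add: star_mult star_e star_cut)
  then show ?thesis using assms by (simp add: e_mult_cut star_e)
qed

lemma sum_cut:
  assumes "k \<le> m"
  shows "(\<Sum>r<n m div n k. cut k m r) = 1"
  unfolding cut_def using sum_levels[OF assms, of "\<lambda>p. e m p p"] by (simp add: sum_e)

lemma cut_mult_cut:
  assumes "k \<le> m" "r < n m div n k" "t < n m div n k"
  shows "cut k m r * cut k m t = (if r = t then cut k m r else 0)"
proof -
  have "cut k m r * cut k m t =
      (\<Sum>i<n k. \<Sum>j<n k. if j = i then if r = t then e m (r * n k + i) (r * n k + i) else 0 else 0)"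
    unfolding cut_def sum_product
  proof (intro sum.cong refl)
    fix i j assume "i \<in> {..<n k}" "j \<in> {..<n k}"
    then have ij: "i < n k" "j < n k" by simp_all
    then have "r * n k + i = t * n k + j \<longleftrightarrow> r = t \<and> i = j"
      by (metis child_div_mod)
    then show "e m (r * n k + i) (r * n k + i) * e m (t * n k + j) (t * n k + j) =
        (if j = i then if r = t then e m (r * n k + i) (r * n k + i) else 0 else 0)"
      using ij child_less[OF assms(1,2), of i] child_less[OF assms(1,3), of j] by (auto simp: e_mult)
  qed
  then show ?thesis by (simp add: cut_def)
qed

lemma pinch_diff: "pinch k m (a - b) = pinch k m a - pinch k m b"
  by (simp add: pinch_def left_diff_distrib right_diff_distrib sum_subtractf)

lemma norm_pinch_le: "k \<le> m \<Longrightarrow> norm (pinch k m a) \<le> norm a"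
  unfolding pinch_def by (intro norm_pinching star_cut cut_mult_cut sum_cut)

text \<open>Multiplying \<open>e k i j\<close> by a cut on either side gives the same child, so the
  cuts commute with level \<open>k\<close>, and they sum to 1.\<close>

lemma pinch_full:
  assumes "k \<le> m"
  shows "pinch k m (full k c) = full k c"
proof -
  have comm: "cut k m r * full k c = full k c * cut k m r" if "r < n m div n k" for r
    unfolding full_def sum_distrib_left sum_distrib_right using assms that
    by (intro sum.cong refl) (simp add: mult_scaleC_left mult_scaleC_right cut_mult_e e_mult_cut)
  have "pinch k m (full k c) = (\<Sum>r<n m div n k. full k c * cut k m r)"
    unfolding pinch_def using assms
    by (intro sum.cong refl) (simp add: comm mult.assoc cut_mult_cut)
  then show ?thesis
    using sum_cut[OF assms] by (simp flip: sum_distrib_left)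
qed

lemma pinch_eq_sum_blocks: "pinch k m a = (\<Sum>i<n k. \<Sum>j<n k. pinch_block k m i j a)"
proof -
  have "pinch k m a = (\<Sum>r<n m div n k. \<Sum>i<n k. \<Sum>j<n k.
      e m (r * n k + i) (r * n k + i) * a * e m (r * n k + j) (r * n k + j))"
    by (simp only: pinch_def cut_def sum_distrib_right) (simp only: sum_distrib_left)
  also have "\<dots> = (\<Sum>i<n k. \<Sum>j<n k. pinch_block k m i j a)"
    unfolding pinch_block_def by (simp add: sum.swap[of _ _ "{..<n m div n k}"])
  finally show ?thesis .
qed

lemma pinch_block_diff: "pinch_block k m i j (a - b) = pinch_block k m i j a - pinch_block k m i j b"
  by (simp add: pinch_block_def left_diff_distrib right_diff_distrib sum_subtractf)

lemma norm_compress_le: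
  assumes "p < n k" "q < n k"
  shows "norm (e k p p * a * e k q q) \<le> norm a"
  using order_trans[OF norm_mult_ineq mult_right_mono[OF norm_mult_ineq norm_ge_zero],
      of "e k p p" a "e k q q"] assms
  by (simp add: norm_e)

text \<open>The block is the corner of \<open>pinch k m a\<close> between \<open>e k i i\<close> and
  \<open>e k j j\<close>; pinching and compression are both contractive.\<close>

lemma norm_pinch_block_le:
  assumes "k \<le> m" "i < n k" "j < n k"
  shows "norm (pinch_block k m i j a) \<le> norm a"
proof -
  have "pinch_block k m i j a = e k i i * pinch k m a * e k j j"
    unfolding pinch_block_def pinch_def sum_distrib_left sum_distrib_right
  proof (intro sum.cong refl)
    fix r assume "r \<in> {..<n m div n k}"
    then have "e k i i * cut k m r = e m (r * n k + i) (r * n k + i)"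
      "cut k m r * e k j j = e m (r * n k + j) (r * n k + j)"
      using assms by (simp_all add: e_mult_cut cut_mult_e)
    then show "e m (r * n k + i) (r * n k + i) * a * e m (r * n k + j) (r * n k + j) =
        e k i i * (cut k m r * a * cut k m r) * e k j j"
      by (metis mult.assoc)
  qed
  then show ?thesis
    using norm_compress_le[OF assms(2,3), of "pinch k m a"] norm_pinch_le[OF assms(1), of a] by simp
qed

lemma pinch_block_in_bimodule:
  assumes "bimodule S" "s \<in> S" "k \<le> m" "i < n k" "j < n k"
  shows "pinch_block k m i j s \<in> S"
  unfolding pinch_block_def using assms child_less[OF assms(3)]
  by (intro scaleC.subspace_sum bimodule_compress) (auto simp: bimodule_def)

lemma pinch_block_full:
  assumes "k \<le> m" "i < n k" "j < n k"
  shows "pinch_block k m i j (full m c) =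
    (\<Sum>r<n m div n k. c (r * n k + i) (r * n k + j) *\<^sub>C e m (r * n k + i) (r * n k + j))"
  unfolding pinch_block_def using assms child_less[OF assms(1)]
  by (intro sum.cong refl full_compress) auto

lemma norm_diag_children_le:
  assumes "k \<le> m" "j < n k" and "\<And>r. r < n m div n k \<Longrightarrow> cmod (c r) \<le> C" "0 \<le> C"
  shows "norm (\<Sum>r<n m div n k. c r *\<^sub>C e m (r * n k + j) (r * n k + j)) \<le> C"
proof (rule norm_diagonal_le)
  fix r t assume "r \<in> {..<n m div n k}" "t \<in> {..<n m div n k}"
  then have rt: "r < n m div n k" "t < n m div n k" by simp_all
  have "r * n k + j = t * n k + j \<longleftrightarrow> r = t"
    using assms(2) by (metis child_div_mod(1))
  then show "e m (r * n k + j) (r * n k + j) * e m (t * n k + j) (t * n k + j) =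
      (if r = t then e m (r * n k + j) (r * n k + j) else 0)"
    using rt assms(2) child_less[OF assms(1)] by (auto simp: e_mult)
qed (use assms in \<open>auto simp: star_e\<close>)

text \<open>The sum is a combination of orthogonal projections times \<open>e k i j\<close>, which
  has norm 1. Hence the bound does not grow with the number of children.\<close>

lemma norm_children_le:
  assumes "k \<le> m" "i < n k" "j < n k" and "\<And>r. r < n m div n k \<Longrightarrow> cmod (c r) \<le> C" "0 \<le> C"
  shows "norm (\<Sum>r<n m div n k. c r *\<^sub>C e m (r * n k + i) (r * n k + j)) \<le> C"
proof -
  let ?d = "\<Sum>r<n m div n k. c r *\<^sub>C e m (r * n k + i) (r * n k + i)"
  have "(\<Sum>r<n m div n k. c r *\<^sub>C e m (r * n k + i) (r * n k + j)) = ?d * e k i j"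
    unfolding sum_distrib_right using assms child_less[OF assms(1)]
    by (intro sum.cong refl) (simp add: mult_scaleC_left e_mult_coarse)
  moreover have "norm ?d \<le> C"
    by (rule norm_diag_children_le) (use assms in auto)
  ultimately show ?thesis
    using norm_mult_ineq[of ?d "e k i j"] assms by (simp add: norm_e)
qed

section \<open>Matrix units in closed bimodules\<close>

text \<open>The projections of level \<open>m\<close> lie below \<open>e k i i\<close> and
  \<open>e k j j\<close>, so compressing by the latter first changes nothing.\<close>

lemma full_compress_child:
  assumes "k \<le> m" "i < n k" "j < n k" "r < n m div n k"
  shows "e m (r * n k + i) (r * n k + i) * full k c * e m (r * n k + j) (r * n k + j) =
    c i j *\<^sub>C e m (r * n k + i) (r * n k + j)"
proof -
  let ?f = "\<lambda>i. e m (r * n k + i) (r * n k + i)"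
  have "?f i * full k c * ?f j = (?f i * e k i i) * full k c * (e k j j * ?f j)"
    using assms child_less[OF assms(1,4)] by (simp add: e_diag_mult)
  also have "\<dots> = ?f i * (e k i i * full k c * e k j j) * ?f j"
    by (simp add: mult.assoc)
  also have "\<dots> = c i j *\<^sub>C (?f i * e k i j * ?f j)"
    using assms by (simp add: full_compress mult_scaleC_left mult_scaleC_right)
  also have "\<dots> = c i j *\<^sub>C e m (r * n k + i) (r * n k + j)"
    using assms by (simp add: e_child)
  finally show ?thesis .
qed

text \<open>Seen at level \<open>m\<close>, \<open>full k c\<close> has the entry
  \<open>c i j\<close> at every child of the position \<open>(i, j)\<close>; compression to one
  entry is contractive.\<close>

lemma child_entry_le:
  assumes "k \<le> m" "i < n k" "j < n k" "r < n m div n k"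
  shows "cmod (b (r * n k + i) (r * n k + j) - c i j) \<le> norm (full m b - full k c)"
proof -
  let ?p = "r * n k + i" and ?q = "r * n k + j"
  have pq: "?p < n m" "?q < n m" using assms child_less by auto
  have "(b ?p ?q - c i j) *\<^sub>C e m ?p ?q = e m ?p ?p * (full m b - full k c) * e m ?q ?q"
    using full_compress[OF pq, of b] full_compress_child[OF assms, of c]
    by (simp add: right_diff_distrib left_diff_distrib scaleC.scale_left_diff_distrib)
  then have "norm ((b ?p ?q - c i j) *\<^sub>C e m ?p ?q) \<le> norm (full m b - full k c)"
    using norm_compress_le[OF pq] by simp
  then show ?thesis using pq by (simp add: norm_scaleC norm_e)
qed

text \<open>After pinching, the \<open>(i, j)\<close> block of a fine approximant of \<open>s\<close> is \<open>e k i j\<close> times a diagonal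
  element whose entries stay away from \<open>0\<close>, so it can be divided out inside the bimodule.\<close>

lemma e_in_closed_bimodule:
  assumes S: "bimodule S" "closed S" and s: "s \<in> S" "norm (s - full k c) < \<epsilon>"
    and ij: "i < n k" "j < n k" and c: "2 * \<epsilon> \<le> cmod (c i j)"
  shows "e k i j \<in> S"
proof -
  have \<epsilon>: "0 < \<epsilon>" using s(2) norm_ge_zero[of "s - full k c"] by linarith
  have "\<exists>u\<in>S. dist u (e k i j) < \<eta>" if \<eta>: "0 < \<eta>" for \<eta>
  proof -
    \<comment> \<open>The bound \<open>\<epsilon> / 2\<close> keeps the fine entries away from 0;
      the other one absorbs the factor \<open>2 / \<epsilon>\<close> from
      \<open>norm d\<close>.\<close>
    define \<delta> where "\<delta> = min (\<epsilon> / 2) (\<eta> * \<epsilon> / 4)"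
    have \<delta>: "0 < \<delta>" "\<delta> \<le> \<epsilon> / 2" "\<delta> \<le> \<eta> * \<epsilon> / 4"
      using \<epsilon> \<eta> by (auto simp: \<delta>_def)
    obtain m b where m: "k \<le> m" and b: "norm (s - full m b) < \<delta>"
      using dense_levels[OF \<delta>(1)] by blast
    let ?b = "\<lambda>r. b (r * n k + i) (r * n k + j)"
    have "norm (full m b - full k c) < \<epsilon> + \<delta>"
      using norm_triangle_ineq4[of "s - full k c" "s - full m b"] s(2) b by simp
    \<comment> \<open>Each fine entry is within
      \<open>\<epsilon> + \<delta> \<le> 3 * \<epsilon> / 2\<close> of \<open>c i j\<close>, whose
      modulus is at least \<open>2 * \<epsilon>\<close>.\<close>
    then have large: "\<epsilon> / 2 \<le> cmod (?b r)" if "r < n m div n k" for r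
      using child_entry_le[OF m ij that, of b c] norm_triangle_ineq2[of "c i j" "?b r"] c \<delta>(2)
      by (simp add: norm_minus_commute)
    \<comment> \<open>Inverts the entries of the block, placed on the columns so that it acts from
      the right.\<close>
    define d where "d = (\<Sum>r<n m div n k. (1 / ?b r) *\<^sub>C e m (r * n k + j) (r * n k + j))"
    have "d \<in> D"
      unfolding d_def using child_less[OF m] ij
      by (intro scaleC.subspace_sum scaleC.subspace_scale masa_subspace e_in_masa) auto
    have norm_d: "norm d \<le> 2 / \<epsilon>"
      unfolding d_def
    proof (rule norm_diag_children_le[OF m ij(2)])
      show "cmod (1 / ?b r) \<le> 2 / \<epsilon>" if "r < n m div n k" for r
        using frac_le[of 1 1 "\<epsilon> / 2" "cmod (?b r)"] large[OF that] \<epsilon>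
        by (simp add: norm_divide)
    qed (use \<epsilon> in simp)
    have "pinch_block k m i j (full m b) * d = (\<Sum>r<n m div n k. e m (r * n k + i) (r * n k + j))"
    proof -
      have "pinch_block k m i j (full m b) * d = (\<Sum>r<n m div n k. \<Sum>t<n m div n k.
          if t = r then e m (r * n k + i) (r * n k + j) else 0)"
        unfolding pinch_block_full[OF m ij] d_def sum_product
      proof (intro sum.cong refl)
        fix r t assume "r \<in> {..<n m div n k}" "t \<in> {..<n m div n k}"
        then have rt: "r < n m div n k" "t < n m div n k" by simp_all
        have "r * n k + j = t * n k + j \<longleftrightarrow> r = t"
          using ij(2) by (metis child_div_mod(1))
        moreover have "?b r \<noteq> 0" using large[OF rt(1)] \<epsilon> by auto
        ultimately show "?b r *\<^sub>C e m (r * n k + i) (r * n k + j) *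
            (1 / ?b t) *\<^sub>C e m (t * n k + j) (t * n k + j) =
            (if t = r then e m (r * n k + i) (r * n k + j) else 0)"
          using rt ij child_less[OF m] by (auto simp: mult_scaleC_left mult_scaleC_right e_mult)
      qed
      then show ?thesis by simp
    qed
    also have "\<dots> = e k i j" by (rule e_refine[OF m ij, symmetric])
    finally have "pinch_block k m i j s * d - e k i j = pinch_block k m i j (s - full m b) * d"
      by (simp add: pinch_block_diff left_diff_distrib)
    then have "dist (pinch_block k m i j s * d) (e k i j) \<le> norm (pinch_block k m i j (s - full m b)) * norm d"
      by (simp add: dist_norm norm_mult_ineq)
    also have "\<dots> \<le> \<delta> * (2 / \<epsilon>)"
      using norm_pinch_block_le[OF m ij, of "s - full m b"] b norm_d \<epsilon> \<delta>
      by (intro mult_mono) auto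
    also have "\<dots> \<le> (\<eta> * \<epsilon> / 4) * (2 / \<epsilon>)"
      using \<delta>(3) \<epsilon> by (intro mult_right_mono) auto
    also have "\<dots> < \<eta>" using \<epsilon> \<eta> by simp
    finally have "dist (pinch_block k m i j s * d) (e k i j) < \<eta>" .
    moreover have "1 * pinch_block k m i j s * d \<in> S"
      using pinch_block_in_bimodule[OF S(1) s(1) m ij] S(1) \<open>d \<in> D\<close> one_in_masa
      unfolding bimodule_def by blast
    ultimately show ?thesis by (intro bexI) auto
  qed
  then have "e k i j \<in> closure S" by (simp add: closure_approachable)
  then show ?thesis using S(2) by simp
qed

lemma closed_bimodule_synthesis:
  assumes S: "bimodule S" "closed S" and s: "s \<in> S" and \<epsilon>: "0 < \<epsilon>"
  shows "\<exists>t\<in>scaleC.span {e m p q | m p q. p < n m \<and> q < n m \<and> e m p q \<in> S}. dist t s < 4 * \<epsilon>"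
proof -
  let ?T = "scaleC.span {e m p q | m p q. p < n m \<and> q < n m \<and> e m p q \<in> S}"
  obtain k c where c: "norm (s - full k c) < \<epsilon>"
    using dense_levels[OF \<epsilon>] by blast
  \<comment> \<open>Chosen so that \<open>(n k)\<^sup>2\<close> blocks with error
    \<open>2 * \<eta>\<close> each cost \<open>\<epsilon>\<close> in total. As \<eta> depends on
    \<open>k\<close>, the level of the first approximant is fixed before the second is
    taken.\<close>
  define \<eta> where "\<eta> = \<epsilon> / (2 * (real (n k))\<^sup>2)"
  have nk: "1 \<le> real (n k)" using n_pos[of k] by simp
  then have "1 \<le> 2 * (real (n k))\<^sup>2" using one_le_power[OF nk, of 2] by linarith
  then have \<eta>: "0 < \<eta>" "\<eta> \<le> \<epsilon>" "(real (n k))\<^sup>2 * (2 * \<eta>) = \<epsilon>"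
    using \<epsilon> nk by (auto simp: \<eta>_def field_simps)
  obtain m b where m: "k \<le> m" and b: "norm (s - full m b) < \<eta>"
    using dense_levels[OF \<eta>(1)] by blast
  \<comment> \<open>The threshold \<open>2 * \<eta>\<close> is the one at which
    \<open>e_in_closed_bimodule\<close> puts the matrix unit into \<open>S\<close>.\<close>
  define b' where "b' p q = (if 2 * \<eta> \<le> cmod (b p q) then b p q else 0)" for p q
  define t where "t = (\<Sum>i<n k. \<Sum>j<n k. pinch_block k m i j (full m b'))"
  have "b' p q *\<^sub>C e m p q \<in> ?T" if "p < n m" "q < n m" for p q
  proof (cases "2 * \<eta> \<le> cmod (b p q)")
    case True
    then have "e m p q \<in> S"
      using e_in_closed_bimodule[OF S s b that] by simp
    then show ?thesis
      using that by (intro scaleC.span_scale scaleC.span_base) blast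
  qed (simp add: b'_def scaleC.span_zero)
  then have t: "t \<in> ?T"
    unfolding t_def using child_less[OF m]
    by (intro scaleC.span_sum) (auto simp: pinch_block_full[OF m] intro!: scaleC.span_sum)
  have "norm (pinch_block k m i j (full m b) - pinch_block k m i j (full m b')) \<le> 2 * \<eta>"
    if "i < n k" "j < n k" for i j
  proof -
    let ?b = "\<lambda>r. b (r * n k + i) (r * n k + j) - b' (r * n k + i) (r * n k + j)"
    have "pinch_block k m i j (full m b) - pinch_block k m i j (full m b') =
        (\<Sum>r<n m div n k. ?b r *\<^sub>C e m (r * n k + i) (r * n k + j))"
      using that by (simp add: pinch_block_full[OF m] scaleC.scale_left_diff_distrib sum_subtractf)
    moreover have "norm (\<Sum>r<n m div n k. ?b r *\<^sub>C e m (r * n k + i) (r * n k + j)) \<le> 2 * \<eta>"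
      by (rule norm_children_le[OF m that]) (use \<eta>(1) in \<open>auto simp: b'_def\<close>)
    ultimately show ?thesis by simp
  qed
  then have "norm (\<Sum>i<n k. \<Sum>j<n k. pinch_block k m i j (full m b) - pinch_block k m i j (full m b'))
      \<le> (\<Sum>i<n k. \<Sum>j<n k. 2 * \<eta>)"
    by (intro sum_norm_le) auto
  then have n1: "norm (pinch k m (full m b) - t) \<le> \<epsilon>"
    using \<eta>(3) by (simp add: pinch_eq_sum_blocks t_def sum_subtractf power2_eq_square mult.assoc)
  have n2: "norm (pinch k m (s - full m b)) < \<epsilon>"
    using norm_pinch_le[OF m, of "s - full m b"] b \<eta>(2) by simp
  have n3: "norm (pinch k m (full k c - s)) < \<epsilon>"
    using norm_pinch_le[OF m, of "full k c - s"] c by (simp add: norm_minus_commute)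
  have tri: "norm (- x - y - z - w) \<le> norm x + norm y + norm z + norm w" for x y z w :: 'a
    using norm_triangle_ineq4[of "- x - y - z" w] norm_triangle_ineq4[of "- x - y" z]
      norm_triangle_ineq4[of "- x" y] by simp
  \<comment> \<open>Four errors of size at most \<epsilon>: truncation, the two approximations after
    pinching, and the first approximation itself; pinching fixes \<open>full k c\<close>.\<close>
  have eq: "t - s = - (pinch k m (full m b) - t) - pinch k m (s - full m b)
      - pinch k m (full k c - s) - (s - full k c)"
    by (simp add: pinch_diff pinch_full[OF m])
  have "norm (t - s) \<le> norm (pinch k m (full m b) - t) + norm (pinch k m (s - full m b))
      + norm (pinch k m (full k c - s)) + norm (s - full k c)"
    unfolding eq by (rule tri)
  also have "\<dots> < 4 * \<epsilon>" using n1 n2 n3 c by linarith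
  finally show ?thesis using t by (auto simp: dist_norm)
qed

section \<open>The correspondence\<close>

text \<open>The generators of \<open>subgraph_system\<close> without their masa factors; the closure
  turns out to be the same.\<close>

definition span_units :: "(('a \<Rightarrow> complex) \<times> ('a \<Rightarrow> complex)) set \<Rightarrow> 'a set" where
  "span_units P = scaleC.span {e k i j | k i j. i < n k \<and> j < n k \<and> E k i j \<subseteq> P}"

lemma span_units_subspace: "scaleC.subspace (span_units P)"
  unfolding span_units_def by (rule scaleC.subspace_span)

lemma e_in_span_units: "i < n k \<Longrightarrow> j < n k \<Longrightarrow> E k i j \<subseteq> P \<Longrightarrow> e k i j \<in> span_units P"
  unfolding span_units_def by (intro scaleC.span_base) blast

text \<open>A finer diagonal unit cuts \<open>e k i j\<close> down to a child or to 0, and the graph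
  of a child lies in \<open>E k i j\<close>; a coarser one leaves it unchanged or kills it.\<close>

lemma e_mult_span_units:
  assumes "i < n k" "j < n k" "E k i j \<subseteq> P" "p < n m"
  shows "e m p p * e k i j \<in> span_units P" and "e k i j * e m p p \<in> span_units P"
proof -
  note zero = scaleC.subspace_0[OF span_units_subspace]
  have child: "e m (p div n k * n k + i) (p div n k * n k + j) \<in> span_units P" if "k \<le> m"
  proof (rule e_in_span_units)
    have p: "p div n k < n m div n k" using that assms by (intro div_less_levels)
    then show "p div n k * n k + i < n m" "p div n k * n k + j < n m"
      using that assms by (intro child_less; simp)+
    show "E m (p div n k * n k + i) (p div n k * n k + j) \<subseteq> P"
      using graph_refine[OF that assms(1,2)] assms(3) p by blast
  qed
  have unit: "e k i j \<in> span_units P" using assms by (intro e_in_span_units)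
  show "e m p p * e k i j \<in> span_units P"
  proof (cases "k \<le> m")
    case True
    then show ?thesis
      using child assms zero e_mult_coarse[OF True assms(1,2,4,4)] by (auto simp: div_mult_mod_eq)
  next
    case False
    then show ?thesis
      using unit assms zero e_mult_fine[of m k p p i j] by (auto simp: div_mult_mod_eq)
  qed
  show "e k i j * e m p p \<in> span_units P"
  proof (cases "k \<le> m")
    case True
    then show ?thesis
      using child assms zero e_mult_fine[OF True assms(1,2,4,4)] by (auto simp: div_mult_mod_eq)
  next
    case False
    then show ?thesis
      using unit assms zero e_mult_coarse[of m k p p i j] by (auto simp: div_mult_mod_eq)
  qed
qed

text \<open>One side at a time: masa induction handles a single matrix unit, and closed-span
  minimality extends this to the closure.\<close>

lemma closure_span_units_mult:
  assumes "d \<in> D" "s \<in> closure (span_units P)" "f \<in> D"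
  shows "d * s * f \<in> closure (span_units P)"
proof -
  let ?V = "closure (span_units P)"
  have V: "scaleC.subspace ?V" "closed ?V"
    by (simp_all add: subspace_closure span_units_subspace)
  note pre = mult_preimage_subspace[OF V(1)] mult_preimage_closed[OF V(2)]
  have left: "d * s * 1 \<in> ?V" if "s \<in> ?V" "d \<in> D" for d s
  proof -
    have "D \<subseteq> {d. 1 * d * e k i j \<in> ?V}" if "i < n k" "j < n k" "E k i j \<subseteq> P" for k i j
      using e_mult_span_units(1)[OF that] closure_subset by (intro masa_subsetI pre) auto
    then have "?V \<subseteq> {s. d * s * 1 \<in> ?V}"
      unfolding span_units_def[of P] using \<open>d \<in> D\<close>
      by (intro closure_span_minimal pre[unfolded span_units_def]) auto
    then show ?thesis using that by blast
  qed
  have right: "1 * s * f \<in> ?V" if "s \<in> ?V" "f \<in> D" for f s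
  proof -
    have "D \<subseteq> {f. e k i j * f * 1 \<in> ?V}" if "i < n k" "j < n k" "E k i j \<subseteq> P" for k i j
      using e_mult_span_units(2)[OF that] closure_subset by (intro masa_subsetI pre) auto
    then have "?V \<subseteq> {s. 1 * s * f \<in> ?V}"
      unfolding span_units_def[of P] using \<open>f \<in> D\<close>
      by (intro closure_span_minimal pre[unfolded span_units_def]) auto
    then show ?thesis using that by blast
  qed
  show ?thesis using right[OF left[OF assms(2,1)] assms(3)] by simp
qed

text \<open>The closed span of the units already absorbs masa factors, and conversely
  \<open>d = f = 1\<close> recovers the units.\<close>

lemma subgraph_system_eq: "subgraph_system n \<phi> P = closure (span_units P)"
proof (rule antisym)
  have "d * e k i j * f \<in> closure (span_units P)"
    if "d \<in> D" "f \<in> D" "i < n k" "j < n k" "E k i j \<subseteq> P" for d f k i j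
    using closure_span_units_mult[OF that(1) _ that(2)] e_in_span_units[OF that(3-5)] closure_subset
    by blast
  then show "subgraph_system n \<phi> P \<subseteq> closure (span_units P)"
    unfolding subgraph_system_def
    by (intro closure_span_minimal subspace_closure span_units_subspace closed_closure) blast
  have "e k i j \<in> {d * e k i j * f | d f k i j.
      d \<in> D \<and> f \<in> D \<and> i < n k \<and> j < n k \<and> E k i j \<subseteq> P}"
    if "i < n k" "j < n k" "E k i j \<subseteq> P" for k i j
    using that one_in_masa
    by (intro CollectI exI[of _ 1] exI[of _ k] exI[of _ i] exI[of _ j]) simp
  then show "closure (span_units P) \<subseteq> subgraph_system n \<phi> P"
    unfolding subgraph_system_def span_units_def
    by (intro closure_mono scaleC.span_mono) blast
qed

text \<open>Reflexivity of \<open>P\<close> supplies the diagonal units, since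
  \<open>E k i i\<close> lies on the diagonal; symmetry supplies the adjoints, since
  \<open>E k j i\<close> is the converse of \<open>E k i j\<close>.\<close>

lemma subgraph_system_in:
  assumes "P \<in> open_subgraphs n \<phi>"
  shows "subgraph_system n \<phi> P \<in> concrete_operator_systems n \<phi>"
proof -
  let ?V = "closure (span_units P)"
  have P: "Id_on X \<subseteq> P" "sym P" using assms by (auto simp: open_subgraphs_def)
  have V: "scaleC.subspace ?V" "closed ?V"
    by (simp_all add: subspace_closure span_units_subspace)
  have "D \<subseteq> ?V"
  proof (rule masa_subsetI[OF V])
    fix k i assume "i < n k"
    moreover from this have "E k i i \<subseteq> P"
      using subsetD[OF P(1) Id_onI[OF cylinder_in_spectrum]]
      by (auto simp: uhf_graph_def shift_diag)
    ultimately show "e k i i \<in> ?V"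
      using e_in_span_units closure_subset by blast
  qed
  moreover have "star ` ?V \<subseteq> ?V"
  proof -
    have "e k j i \<in> ?V" if "i < n k" "j < n k" "E k i j \<subseteq> P" for k i j
    proof -
      have "E k j i \<subseteq> P"
        using graph_converse[OF that(2,1)] that(3) symD[OF P(2)] by (auto simp: subset_iff)
      then show ?thesis using e_in_span_units that closure_subset by blast
    qed
    then have "?V \<subseteq> {s. star s \<in> ?V}"
      unfolding span_units_def[of P]
      by (intro closure_span_minimal star_preimage_subspace star_preimage_closed
          V[unfolded span_units_def]) (auto simp: star_e)
    then show ?thesis by blast
  qed
  ultimately show ?thesis
    unfolding concrete_operator_systems_def subgraph_system_eq
    using V closure_span_units_mult by blast
qed

section \<open>The inverse map\<close>

definition unit_graph :: "'a set \<Rightarrow> (('a \<Rightarrow> complex) \<times> ('a \<Rightarrow> complex)) set" where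
  "unit_graph S = \<Union>{E k i j | k i j. i < n k \<and> j < n k \<and> e k i j \<in> S}"

lemma unit_graph_in:
  assumes "S \<in> concrete_operator_systems n \<phi>"
  shows "unit_graph S \<in> open_subgraphs n \<phi>"
proof -
  have S: "star ` S \<subseteq> S" "D \<subseteq> S"
    using assms by (auto simp: concrete_operator_systems_def)
  have "openin (uhf_relation n \<phi>) (unit_graph S)"
    unfolding unit_graph_def using openin_graph by (intro openin_Union) blast
  moreover have "Id_on X \<subseteq> unit_graph S"
  proof
    fix z assume "z \<in> Id_on X"
    then obtain x where x: "z = (x, x)" "x \<in> X" by auto
    obtain i where i: "i < n 0" "x \<in> cyl 0 i" using cylinder_exists[OF x(2)] by blast
    then have "z \<in> E 0 i i" using shift_diag[OF i(2,1)] x by (auto simp: uhf_graph_def)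
    moreover have "e 0 i i \<in> S" using S(2) e_in_masa[OF i(1)] by blast
    ultimately show "z \<in> unit_graph S" using i unfolding unit_graph_def by blast
  qed
  moreover have "sym (unit_graph S)"
  proof (rule symI)
    fix x y assume "(x, y) \<in> unit_graph S"
    then obtain k i j where ij: "i < n k" "j < n k" "e k i j \<in> S" "(x, y) \<in> E k i j"
      unfolding unit_graph_def by blast
    then have "e k j i \<in> S" using S(1) star_e[of k i j] by (metis image_subset_iff)
    then show "(y, x) \<in> unit_graph S"
      using ij graph_converse[OF ij(1,2,4)] unfolding unit_graph_def by blast
  qed
  ultimately show ?thesis by (simp add: open_subgraphs_def)
qed

text \<open>Graph refinement keeps the support inside \<open>P\<close> at all finer levels, so the
  level can later be chosen fine enough for a given matrix unit too.\<close>

lemma span_units_level: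
  assumes "a \<in> span_units P"
  shows "\<exists>k. \<forall>m\<ge>k. a \<in> level m (\<lambda>p q. E m p q \<subseteq> P)"
proof -
  have "span_units P \<subseteq> {a. \<exists>k. \<forall>m\<ge>k. a \<in> level m (\<lambda>p q. E m p q \<subseteq> P)}"
    unfolding span_units_def
  proof (rule scaleC.span_minimal[OF _ subspace_eventually[OF subspace_level]], rule subsetI)
    fix a assume "a \<in> {e k i j | k i j. i < n k \<and> j < n k \<and> E k i j \<subseteq> P}"
    then obtain k i j where a: "a = e k i j" "i < n k" "j < n k" "E k i j \<subseteq> P" by blast
    have "a \<in> level m (\<lambda>p q. E m p q \<subseteq> P)" if "k \<le> m" for m
      unfolding a(1)
    proof (rule e_in_finer_level[OF that a(2,3)])
      show "E m (r * n k + i) (r * n k + j) \<subseteq> P" if "r < n m div n k" for r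
        using a(4) graph_refine[OF \<open>k \<le> m\<close> a(2,3)] that by blast
    qed
    then show "a \<in> {a. \<exists>k. \<forall>m\<ge>k. a \<in> level m (\<lambda>p q. E m p q \<subseteq> P)}" by blast
  qed
  then show ?thesis using assms by blast
qed

lemma graph_subset_if_e_in_system:
  assumes "e k i j \<in> closure (span_units P)" and ij: "i < n k" "j < n k"
  shows "E k i j \<subseteq> P"
proof -
  \<comment> \<open>Distance below 1 suffices: each child has coefficient 1 in
    \<open>e k i j\<close>, so its coefficient in \<open>a\<close> cannot be 0.\<close>
  obtain a where a: "a \<in> span_units P" "dist a (e k i j) < 1"
    using assms(1)[unfolded closure_approachable, THEN spec, of 1] by auto
  obtain l where l: "\<And>m. l \<le> m \<Longrightarrow> a \<in> level m (\<lambda>p q. E m p q \<subseteq> P)"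
    using span_units_level[OF a(1)] by blast
  define m where "m = max k l"
  have m: "k \<le> m" "l \<le> m" by (simp_all add: m_def)
  obtain c where c: "a = full m c" "\<forall>p<n m. \<forall>q<n m. c p q \<noteq> 0 \<longrightarrow> E m p q \<subseteq> P"
    using l[OF m(2)] unfolding level_def by blast
  have "E m (r * n k + i) (r * n k + j) \<subseteq> P" if r: "r < n m div n k" for r
  proof -
    let ?p = "r * n k + i" and ?q = "r * n k + j"
    have pq: "?p < n m" "?q < n m" using r ij child_less[OF m(1)] by auto
    have "e m ?p ?p * (a - e k i j) * e m ?q ?q = (c ?p ?q - 1) *\<^sub>C e m ?p ?q"
      using full_compress[OF pq, of c] e_child[OF m(1) ij r]
      by (simp add: c(1) right_diff_distrib left_diff_distrib scaleC.scale_left_diff_distrib)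
    then have "cmod (c ?p ?q - 1) \<le> norm (a - e k i j)"
      using norm_compress_le[OF pq, of "a - e k i j"] pq by (simp add: norm_scaleC norm_e)
    then have "c ?p ?q \<noteq> 0" using a(2) by (auto simp: dist_norm)
    then show ?thesis using c(2) pq by blast
  qed
  then show ?thesis using graph_refine[OF m(1) ij] by blast
qed

lemma unit_graph_subgraph_system:
  assumes "P \<in> open_subgraphs n \<phi>"
  shows "unit_graph (subgraph_system n \<phi> P) = P"
proof (intro equalityI subsetI)
  fix z assume "z \<in> unit_graph (subgraph_system n \<phi> P)"
  then show "z \<in> P"
    unfolding unit_graph_def subgraph_system_eq using graph_subset_if_e_in_system by blast
next
  fix z assume z: "z \<in> P"
  have "openin (uhf_relation n \<phi>) P" using assms by (simp add: open_subgraphs_def)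
  then obtain k i j where ij: "i < n k" "j < n k" "z \<in> E k i j" "E k i j \<subseteq> P"
    using open_relation_base z by blast
  then have "e k i j \<in> closure (span_units P)"
    using e_in_span_units closure_subset by blast
  then show "z \<in> unit_graph (subgraph_system n \<phi> P)"
    using ij unfolding unit_graph_def subgraph_system_eq by blast
qed

lemma subgraph_system_unit_graph:
  assumes "S \<in> concrete_operator_systems n \<phi>"
  shows "subgraph_system n \<phi> (unit_graph S) = S"
proof -
  have S: "bimodule S" "closed S"
    using assms by (auto simp: concrete_operator_systems_def bimodule_def)
  \<comment> \<open>This identifies the generators of \<open>span_units (unit_graph S)\<close> with
    the matrix units in \<open>S\<close>, so that synthesis applies. A graph could a priori be
    covered by graphs of other units; \<open>graph_not_covered\<close> excludes this when its own
    unit is missing.\<close>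
  have "e k i j \<in> S \<longleftrightarrow> E k i j \<subseteq> unit_graph S" if ij: "i < n k" "j < n k" for k i j
  proof
    assume "e k i j \<in> S"
    then show "E k i j \<subseteq> unit_graph S" using ij unfolding unit_graph_def by blast
  next
    assume cov: "E k i j \<subseteq> unit_graph S"
    show "e k i j \<in> S"
    proof (rule ccontr)
      assume "e k i j \<notin> S"
      then obtain z where z: "z \<in> E k i j"
          "\<And>m p q. p < n m \<Longrightarrow> q < n m \<Longrightarrow> e m p q \<in> S \<Longrightarrow> z \<notin> E m p q"
        using graph_not_covered[OF S(1) ij] by blast
      then show False using cov unfolding unit_graph_def by blast
    qed
  qed
  then have span: "span_units (unit_graph S) =
      scaleC.span {e m p q | m p q. p < n m \<and> q < n m \<and> e m p q \<in> S}" (is "_ = scaleC.span ?G")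
    unfolding span_units_def by (intro arg_cong[where f = scaleC.span]) blast
  have "closure (scaleC.span ?G) = S"
  proof (rule antisym)
    show "closure (scaleC.span ?G) \<subseteq> S"
      using S by (intro closure_span_minimal) (auto simp: bimodule_def)
    show "S \<subseteq> closure (scaleC.span ?G)"
    proof
      fix s assume s: "s \<in> S"
      have "\<exists>t\<in>scaleC.span ?G. dist t s < \<epsilon>" if "0 < \<epsilon>" for \<epsilon>
        using closed_bimodule_synthesis[OF S s, of "\<epsilon> / 4"] that by simp
      then show "s \<in> closure (scaleC.span ?G)" by (simp add: closure_approachable)
    qed
  qed
  then show ?thesis by (simp add: subgraph_system_eq span)
qed

lemma subgraph_system_bij:
  "bij_betw (subgraph_system n \<phi>) (open_subgraphs n \<phi>) (concrete_operator_systems n \<phi>)"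
  by (rule bij_betw_byWitness[where f' = unit_graph])
    (auto simp: unit_graph_subgraph_system subgraph_system_unit_graph subgraph_system_in unit_graph_in)

end

theorem theorem6p12:
  fixes n :: "nat \<Rightarrow> nat" and \<phi> :: "nat \<Rightarrow> complex mat \<Rightarrow> 'a::cstar_algebra_1"
  assumes "uhf_limit n \<phi>"
  shows "bij_betw (subgraph_system n \<phi>) (open_subgraphs n \<phi>) (concrete_operator_systems n \<phi>)"
proof -
  interpret uhf_algebra n \<phi> by unfold_locales (rule assms)
  show ?thesis by (rule subgraph_system_bij)
qed

end
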